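(* Fix an integer $b\ge 2$ and $m\in\mathbb N_0$, and let the tensor network approximation sets be defined with $S=\mathbb P_m$ (see context). For $\rho>1$ define $$D_\rho:=\Big\{z\in\mathbb C:\ \operatorname{dist}(z,[0,1])<\frac{\rho-1}{2}\Big\}.$$ Let $\rho=\rho(f)>1$ be such that $f:[0,1)\to\mathbb R$ has an analytic extension onto $D_\rho\subset\mathbb C$, but not onto any $D_{\tilde\rho}$ for $\tilde\rho>\rho$. Then there is a constant $C=C(f,m,b,\rho)$ such that for all $n\in\mathbb N$ $$E_n^{\mathcal N}(f)_\infty\le C\,[\min(\rho,b^{m+1})]^{-n^{1/2}},$$ $$E_n^{\mathcal S}(f)_\infty\le E_n^{\mathcal C}(f)_\infty\le C\,[\min(\rho,b^{(m+1)/b})]^{-n^{1/3}}.$$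
   Context: $\operatorname{dist}(z,D)=\inf_{w\in D}|z-w|$; $\mathbb N=\{1,2,\dots\}$. $\mathbb P_m$ is the space of polynomials of degree at most $m$. Tensor networks. Let $I_b=\{0,\dots,b-1\}$. For $d\in\mathbb N$ and $f:[0,1)\to\mathbb R$, the tensorization is $(T_{b,d}f)(i_1,\dots,i_d,y)=f\big(\sum_{k=1}^d i_kb^{-k}+b^{-d}y\big)$, $i_k\in I_b$, $y\in[0,1)$. Fix a basis $(\varphi_k)_{k=1}^{m+1}$ of $\mathbb P_m$. For $d\in\mathbb N$ and $\boldsymbol r=(r_1,\dots,r_d)\in\mathbb N^d$, a tensor network is a tuple $\mathbf v=(v_1,\dots,v_{d+1})\in\mathbb R^{b\times r_1}\times\mathbb R^{b\times r_1\times r_2}\times\cdots\times\mathbb R^{b\times r_{d-1}\times r_d}\times\mathbb R^{r_d\times(m+1)}$; its realization is the function $f$ with $$(T_{b,d}f)(i_1,\dots,i_d,y)=\sum_{k_1=1}^{r_1}\cdots\sum_{k_d=1}^{r_d}\sum_{k_{d+1}=1}^{m+1}v_1^{k_1}(i_1)v_2^{k_1,k_2}(i_2)\cdots v_d^{k_{d-1},k_d}(i_d)v_{d+1}^{k_d,k_{d+1}}\varphi_{k_{d+1}}(y).$$ Complexities of $\mathbf v$: $\mathrm{compl}_{\mathcal N}(\mathbf v)=\sum_{\nu=1}^d r_\nu$; $\mathrm{compl}_{\mathcal C}(\mathbf v)=br_1+b\sum_{k=2}^d r_{k-1}r_k+r_d(m+1)$; $\mathrm{compl}_{\mathcal S}(\mathbf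 v)=\sum_{\nu=1}^{d+1}\|v_\nu\|_{\ell_0}$ (number of non-zero entries). The complexity of a function is the minimum of the complexity over all tensor networks (all $d$, $\boldsymbol r$) realizing it. For $n\in\mathbb N$, $\Phi_n^{\mathcal N},\Phi_n^{\mathcal C},\Phi_n^{\mathcal S}$ are the sets of functions realizable by tensor networks whose respective complexity is at most $n$; moreover $0\in\Phi_n$ for all $n$. For $\mathcal X\in\{\mathcal N,\mathcal C,\mathcal S\}$, $E_n^{\mathcal X}(f)_\infty=\inf_{\varphi\in\Phi_n^{\mathcal X}}\|f-\varphi\|_{L^\infty([0,1))}$. *)

theory Defs
  imports
    "HOL-Complex_Analysis.Complex_Analysis"
    "HOL-Probability.Essential_Supremum"
    "HOL-Computational_Algebra.Polynomial"
begin

text \<open>Functions on \<open>[0,1)\<close> are represented by total functions on the reals whose values outside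
  of \<open>{0..<1}\<close> are never used. Likewise, multi-indices \<open>(i\<^sub>1,\<dots>,i\<^sub>d)\<close> are functions on \<open>nat\<close> of which
  only the values at \<open>1,\<dots>,d\<close> matter.\<close>

definition tensorize :: "nat \<Rightarrow> nat \<Rightarrow> (real \<Rightarrow> real) \<Rightarrow> (nat \<Rightarrow> nat) \<Rightarrow> real \<Rightarrow> real" where
  "tensorize b d f i y = f ((\<Sum>k=1..d. real (i k) / real b ^ k) + y / real b ^ d)"

definition poly_basis :: "nat \<Rightarrow> (nat \<Rightarrow> real poly) \<Rightarrow> bool" where
  "poly_basis m \<phi> \<longleftrightarrow>
     inj_on \<phi> {1..m+1} \<and>
     module.independent smult (\<phi> ` {1..m+1}) \<and>
     module.span smult (\<phi> ` {1..m+1}) = {p. degree p \<le> m}"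

text \<open>A network of depth \<open>d\<close> with ranks \<open>r 1, \<dots>, r d\<close>. With \<open>i < b\<close>, \<open>k\<^sub>\<nu> \<in> {1..r \<nu>}\<close> and
  \<open>q \<in> {1..m+1}\<close>, the entries are
  \<open>first_core v i k\<^sub>1\<close> for \<open>v\<^sub>1\<close>,
  \<open>mid_core v \<nu> i k\<^sub>\<nu>\<^sub>-\<^sub>1 k\<^sub>\<nu>\<close> for \<open>v\<^sub>\<nu>\<close> with \<open>2 \<le> \<nu> \<le> d\<close>, and
  \<open>last_core v k\<^sub>d q\<close> for \<open>v\<^sub>d\<^sub>+\<^sub>1\<close>.
  Entries with indices out of these ranges are ignored by all definitions below.\<close>

record tensor_network =
  depth :: nat
  rank :: "nat \<Rightarrow> nat"
  first_core :: "nat \<Rightarrow> nat \<Rightarrow> real"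
  mid_core :: "nat \<Rightarrow> nat \<Rightarrow> nat \<Rightarrow> nat \<Rightarrow> real"
  last_core :: "nat \<Rightarrow> nat \<Rightarrow> real"

definition wf_network :: "tensor_network \<Rightarrow> bool" where
  "wf_network v \<longleftrightarrow> depth v \<ge> 1 \<and> (\<forall>\<nu>\<in>{1..depth v}. rank v \<nu> \<ge> 1)"

definition contraction ::
  "nat \<Rightarrow> (nat \<Rightarrow> real poly) \<Rightarrow> tensor_network \<Rightarrow> (nat \<Rightarrow> nat) \<Rightarrow> real \<Rightarrow> real" where
  "contraction m \<phi> v i y =
     (\<Sum>k\<in>(\<Pi>\<^sub>E \<nu>\<in>{1..depth v}. {1..rank v \<nu>}). \<Sum>q=1..m+1.
        first_core v (i 1) (k 1)
        * (\<Prod>\<nu>=2..depth v. mid_core v \<nu> (i \<nu>) (k (\<nu> - 1)) (k \<nu>))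
        * last_core v (k (depth v)) q
        * poly (\<phi> q) y)"

definition realizes ::
  "nat \<Rightarrow> nat \<Rightarrow> (nat \<Rightarrow> real poly) \<Rightarrow> tensor_network \<Rightarrow> (real \<Rightarrow> real) \<Rightarrow> bool" where
  "realizes b m \<phi> v f \<longleftrightarrow>
     (\<forall>i y. (\<forall>\<nu>\<in>{1..depth v}. i \<nu> < b) \<longrightarrow> y \<in> {0..<1} \<longrightarrow>
        tensorize b (depth v) f i y = contraction m \<phi> v i y)"

text \<open>All three measures take \<open>b\<close> and \<open>m\<close> as arguments, although \<open>compl_N\<close> does not depend on
  them, so that they can be passed uniformly to the approximation sets.\<close>

definition compl_N :: "nat \<Rightarrow> nat \<Rightarrow> tensor_network \<Rightarrow> nat" where
  "compl_N b m v = (\<Sum>\<nu>=1..depth v. rank v \<nu>)"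

definition compl_C :: "nat \<Rightarrow> nat \<Rightarrow> tensor_network \<Rightarrow> nat" where
  "compl_C b m v =
     b * rank v 1 + b * (\<Sum>k=2..depth v. rank v (k - 1) * rank v k) + rank v (depth v) * (m + 1)"

definition compl_S :: "nat \<Rightarrow> nat \<Rightarrow> tensor_network \<Rightarrow> nat" where
  "compl_S b m v =
     card {(i, k). i < b \<and> k \<in> {1..rank v 1} \<and> first_core v i k \<noteq> 0}
     + (\<Sum>\<nu>=2..depth v. card {(i, k, l). i < b \<and> k \<in> {1..rank v (\<nu> - 1)} \<and> l \<in> {1..rank v \<nu>}
          \<and> mid_core v \<nu> i k l \<noteq> 0})
     + card {(k, q). k \<in> {1..rank v (depth v)} \<and> q \<in> {1..m+1} \<and> last_core v k q \<noteq> 0}"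

text \<open>The zero function is inserted by convention: no network has \<open>compl_C\<close> less than \<open>b + m + 1\<close>.\<close>

definition approx_set ::
  "(nat \<Rightarrow> nat \<Rightarrow> tensor_network \<Rightarrow> nat) \<Rightarrow> nat \<Rightarrow> nat \<Rightarrow> (nat \<Rightarrow> real poly) \<Rightarrow> nat \<Rightarrow> (real \<Rightarrow> real) set"
  where
  "approx_set cpl b m \<phi> n =
     insert (\<lambda>_. 0) {g. \<exists>v. wf_network v \<and> realizes b m \<phi> v g \<and> cpl b m v \<le> n}"

text \<open>Extended-real valued, hence \<open>\<infinity>\<close> for functions that are not essentially bounded.\<close>

definition Linf_norm :: "(real \<Rightarrow> real) \<Rightarrow> ereal" where
  "Linf_norm g = esssup (lebesgue_on {0..<1}) (\<lambda>x. ereal \<bar>g x\<bar>)"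

definition best_error ::
  "(nat \<Rightarrow> nat \<Rightarrow> tensor_network \<Rightarrow> nat) \<Rightarrow> nat \<Rightarrow> nat \<Rightarrow> (nat \<Rightarrow> real poly) \<Rightarrow> nat \<Rightarrow> (real \<Rightarrow> real) \<Rightarrow> ereal"
  where
  "best_error cpl b m \<phi> n f = (INF g\<in>approx_set cpl b m \<phi> n. Linf_norm (\<lambda>x. f x - g x))"

abbreviation "E_N \<equiv> best_error compl_N"
abbreviation "E_C \<equiv> best_error compl_C"
abbreviation "E_S \<equiv> best_error compl_S"

definition D_region :: "real \<Rightarrow> complex set" where
  "D_region \<rho> = {z. infdist z (complex_of_real ` {0..1}) < (\<rho> - 1) / 2}"

definition has_analytic_extension :: "(real \<Rightarrow> real) \<Rightarrow> complex set \<Rightarrow> bool" where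
  "has_analytic_extension f U \<longleftrightarrow>
     (\<exists>F. F analytic_on U \<and> (\<forall>x\<in>{0..<1}. F (complex_of_real x) = complex_of_real (f x)))"

end

theory Submission
  imports Defs
begin

text \<open>
  A polynomial \<open>P\<close> of degree less than \<open>R\<close> is a cheap network at every depth: reading a further base
  \<open>b\<close> digit of \<open>x\<close> is the affine substitution \<open>t \<mapsto> (i + t)/b\<close>, which acts on polynomials of degree less
  than \<open>R\<close> by an \<open>R \<times> R\<close> matrix. After \<open>d\<close> digits the network knows \<open>P\<close> as a polynomial in the local
  variable of one of the \<open>b^d\<close> intervals of length \<open>b^(-d)\<close>. The last core may only output degree at
  most \<open>m\<close>, and replaces this local polynomial by its Lagrange interpolant at \<open>m + 1\<close> equidistant nodes
  (\<open>network_realizing_piecewise_interpolant\<close>). All ranks are \<open>R\<close>, so the total rank is \<open>d R\<close> and the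
  full number of entries is about \<open>b d R\<^sup>2\<close>.

  The error has two parts. The stadium \<open>D_region \<rho>\<close> contains the closed Bernstein ellipse of parameter
  \<open>\<rho>\<close> with foci \<open>0\<close> and \<open>1\<close> (\<open>joukowski_in_D_region\<close>), so that polynomials of degree less than \<open>R\<close>
  approximate \<open>f\<close> up to a multiple of \<open>\<rho>^(-R)\<close>; a Hermite remainder formula with Chebyshev nodes proves
  this in one contour integral (\<open>bernstein_approximation\<close>). Local interpolation of degree \<open>m\<close> on
  intervals of length \<open>b^(-d)\<close> costs a multiple of \<open>b^(-(m+1)d)\<close>. Comparing with the Taylor polynomials of
  \<open>f\<close> instead of those of \<open>P\<close> keeps this multiple independent of \<open>R\<close>
  (\<open>piecewise_interpolant_error\<close>).

  It remains to balance \<open>\<rho>^(-R)\<close> against \<open>b^(-(m+1)d)\<close>. For the total rank, \<open>R\<close> and \<open>d\<close> are both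
  \<open>n^(1/2)\<close> up to rounding. For the number of entries, \<open>R\<close> is \<open>n^(1/3)\<close> and \<open>d\<close> is \<open>n^(1/3)/b\<close> up to
  rounding, which is where the base \<open>b^((m+1)/b)\<close> comes from.
\<close>

section \<open>Chebyshev polynomials in the Joukowski coordinate\<close>

text \<open>Half the classical Joukowski map \<open>(w + 1/w)/2\<close>, recentred so that the unit circle is folded
  onto \<open>[0,1]\<close>. It takes the circle of radius \<open>\<rho>\<close> to an ellipse with foci \<open>0\<close> and \<open>1\<close>.\<close>

definition joukowski :: "complex \<Rightarrow> complex" where
  "joukowski w = 1/2 + (w + inverse w) / 4"

text \<open>The Chebyshev polynomials of the first kind, transplanted from \<open>[-1,1]\<close> to \<open>[0,1]\<close>.\<close>

fun cheb01 :: "nat \<Rightarrow> complex poly" where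
  "cheb01 0 = 1"
| "cheb01 (Suc 0) = [:-1, 2:]"
| "cheb01 (Suc (Suc n)) = 2 * [:-1, 2:] * cheb01 (Suc n) - cheb01 n"

lemma degree_cheb01: "degree (cheb01 n) \<le> n"
proof (induction n rule: cheb01.induct)
  case (3 n)
  have "degree (2 * [:-1, 2:] * cheb01 (Suc n)) \<le> degree (2 * [:-1, 2::complex:]) + degree (cheb01 (Suc n))"
    by (rule degree_mult_le)
  also have "degree (2 * [:-1, 2::complex:]) \<le> 1"
    by (rule order_trans[OF degree_mult_le]) simp
  finally have "degree (2 * [:-1, 2:] * cheb01 (Suc n)) \<le> Suc (Suc n)"
    using "3.IH" by linarith
  then show ?case
    using "3.IH" by (simp only: cheb01.simps) (intro degree_diff_le, auto)
qed simp_all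

text \<open>In the coordinate \<open>w\<close> the Chebyshev polynomials are symmetrized monomials. This one identity gives
  both estimates below: boundedness on \<open>[0,1]\<close>, where \<open>\<bar>w\<bar> = 1\<close>, and growth like \<open>\<rho>^n\<close> on the
  ellipse \<open>\<bar>w\<bar> = \<rho>\<close>.\<close>

lemma poly_cheb01_joukowski:
  assumes "w \<noteq> 0"
  shows "poly (cheb01 n) (joukowski w) = (w ^ n + inverse w ^ n) / 2"
proof (induction n rule: cheb01.induct)
  case (3 n)
  have two: "2 * (2 * joukowski w - 1) = w + inverse w"
    by (simp add: joukowski_def field_simps)
  have "poly (cheb01 (Suc (Suc n))) (joukowski w)
      = 2 * (2 * joukowski w - 1) * poly (cheb01 (Suc n)) (joukowski w) - poly (cheb01 n) (joukowski w)"
    by (simp add: algebra_simps)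
  also have "\<dots> = (w + inverse w) * ((w ^ Suc n + inverse w ^ Suc n) / 2) - (w ^ n + inverse w ^ n) / 2"
    unfolding two "3.IH" ..
  also have "\<dots> = (w ^ Suc (Suc n) + inverse w ^ Suc (Suc n)) / 2"
    using assms by (simp add: field_simps)
  finally show ?case .
qed (simp_all add: joukowski_def)

lemma joukowski_unit_circle:
  "joukowski (cis \<theta>) = complex_of_real ((1 + cos \<theta>) / 2)"
  by (auto simp: joukowski_def complex_eq_iff cis_inverse)

lemma cmod_cheb01_le_1:
  assumes "x \<in> {0..1::real}"
  shows "cmod (poly (cheb01 n) (complex_of_real x)) \<le> 1"
proof -
  define u where "u = cis (arccos (2 * x - 1))"
  have "complex_of_real x = joukowski u"
    unfolding u_def joukowski_unit_circle using assms by (subst cos_arccos) auto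
  moreover have "u \<noteq> 0" "cmod u = 1" by (auto simp: u_def)
  ultimately show ?thesis
    using norm_triangle_ineq[of "u ^ n" "inverse u ^ n"]
    by (simp add: poly_cheb01_joukowski norm_divide norm_power norm_inverse)
qed

lemma cmod_cheb01_ge:
  assumes "cmod w = \<rho>" "\<rho> > 1" "n \<ge> 1"
  shows "cmod (poly (cheb01 n) (joukowski w)) \<ge> \<rho> ^ n * ((1 - 1 / \<rho>) / 2)"
proof -
  have "w \<noteq> 0" using assms by auto
  have "1 / \<rho> \<le> 1" using assms by simp
  have "(1 / \<rho>) ^ n \<le> (1 / \<rho>) ^ 1"
    using assms by (intro power_decreasing) auto
  also have "\<dots> = 1 / \<rho> * 1" by simp
  also have "\<dots> \<le> 1 / \<rho> * \<rho> ^ n"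
    using assms by (intro mult_left_mono) auto
  finally have le: "(1 / \<rho>) ^ n \<le> 1 / \<rho> * \<rho> ^ n" .
  have "cmod (w ^ n) - cmod (inverse w ^ n) \<le> cmod (w ^ n + inverse w ^ n)"
    by (metis norm_diff_ineq)
  then have "\<rho> ^ n - (1 / \<rho>) ^ n \<le> cmod (w ^ n + inverse w ^ n)"
    using assms by (simp add: norm_power norm_divide inverse_eq_divide)
  with le have "\<rho> ^ n * (1 - 1 / \<rho>) \<le> cmod (w ^ n + inverse w ^ n)"
    by (simp add: algebra_simps)
  then show ?thesis
    using \<open>w \<noteq> 0\<close> by (simp add: poly_cheb01_joukowski norm_divide)
qed

section \<open>Ellipses inside the stadium around the unit interval\<close>

lemma D_region_iff:
  "z \<in> D_region \<rho> \<longleftrightarrow> (\<exists>x\<in>{0..1}. dist z (complex_of_real x) < (\<rho> - 1) / 2)"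
proof
  have "closed (complex_of_real ` {0..1})"
    by (intro compact_imp_closed compact_continuous_image continuous_intros) auto
  then obtain y where "y \<in> complex_of_real ` {0..1}" "infdist z (complex_of_real ` {0..1}) = dist z y"
    by (rule infdist_attains_inf) auto
  moreover assume "z \<in> D_region \<rho>"
  ultimately show "\<exists>x\<in>{0..1}. dist z (complex_of_real x) < (\<rho> - 1) / 2"
    by (auto simp: D_region_def)
next
  assume "\<exists>x\<in>{0..1}. dist z (complex_of_real x) < (\<rho> - 1) / 2"
  then show "z \<in> D_region \<rho>"
    unfolding D_region_def mem_Collect_eq by (meson imageI infdist_le le_less_trans)
qed

lemma open_D_region: "open (D_region \<rho>)"
  unfolding D_region_def by (intro open_Collect_less continuous_intros)

text \<open>Convexity is what lets the Cauchy integral formula be applied to any closed path in the region.\<close>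

lemma convex_D_region: "convex (D_region \<rho>)"
proof (rule convexI)
  fix y z :: complex and u v :: real
  assume yz: "y \<in> D_region \<rho>" "z \<in> D_region \<rho>" and uv: "0 \<le> u" "0 \<le> v" "u + v = 1"
  from yz obtain s t where st: "s \<in> {0..1}" "dist y (complex_of_real s) < (\<rho> - 1) / 2"
      "t \<in> {0..1}" "dist z (complex_of_real t) < (\<rho> - 1) / 2"
    by (auto simp: D_region_iff)
  have "dist (u *\<^sub>R y + v *\<^sub>R z) (complex_of_real (u * s + v * t))
      = cmod (u *\<^sub>R (y - of_real s) + v *\<^sub>R (z - of_real t))"
    by (simp add: dist_norm scaleR_conv_of_real algebra_simps)
  also have "\<dots> \<le> u * dist y (of_real s) + v * dist z (of_real t)"
    using uv by (intro norm_triangle_le) (simp add: dist_norm)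
  also have "\<dots> < (\<rho> - 1) / 2"
    using convex_bound_lt[OF st(2,4) uv] by simp
  finally have "dist (u *\<^sub>R y + v *\<^sub>R z) (complex_of_real (u * s + v * t)) < (\<rho> - 1) / 2" .
  moreover have "u * s + v * t \<in> {0..1}"
    using convexD_alt[of "{0..1::real}" s t v] convex_bound_le[of s 1 t u v] st uv by auto
  ultimately show "u *\<^sub>R y + v *\<^sub>R z \<in> D_region \<rho>"
    unfolding D_region_iff by blast
qed

lemma unit_interval_subset_D_region:
  assumes "\<rho> > 1" "x \<in> {0..1}"
  shows "complex_of_real x \<in> D_region \<rho>"
  unfolding D_region_iff using assms by (intro bexI[of _ x]) auto

text \<open>Moving \<open>w\<close> radially to the unit circle moves \<open>joukowski w\<close> to a point of \<open>[0,1]\<close>. The displacement is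
  at most \<open>((\<rho> - 1) + (1 - 1/\<rho>))/4\<close>, and \<open>1 - 1/\<rho> < \<rho> - 1\<close>. Thus the stadium of width \<open>(\<rho> - 1)/2\<close>
  contains the closed ellipse of parameter \<open>\<rho>\<close>, boundary included, and the approximation rate
  \<open>\<rho>^(-n)\<close> is reached without any loss in the base.\<close>

lemma joukowski_in_D_region:
  assumes "cmod w = \<rho>" "\<rho> > 1"
  shows "joukowski w \<in> D_region \<rho>"
proof -
  define u where "u = cis (Arg w)"
  have w: "w = of_real \<rho> * u"
    using assms rcis_cmod_Arg[of w] by (simp add: rcis_def u_def)
  have u: "cmod u = 1" "u \<noteq> 0" by (auto simp: u_def)
  have "joukowski w - joukowski u = (of_real (\<rho> - 1) * u + of_real (1 / \<rho> - 1) * inverse u) / 4"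
    using assms by (simp add: joukowski_def w inverse_eq_divide diff_divide_distrib algebra_simps)
  then have "dist (joukowski w) (joukowski u)
      = cmod (of_real (\<rho> - 1) * u + of_real (1 / \<rho> - 1) * inverse u) / 4"
    by (simp only: dist_norm norm_divide norm_numeral)
  also have "\<dots> \<le> (\<bar>\<rho> - 1\<bar> + \<bar>1 / \<rho> - 1\<bar>) / 4"
    using norm_triangle_ineq[of "of_real (\<rho> - 1) * u" "of_real (1 / \<rho> - 1) * inverse u"] u
    unfolding norm_mult norm_inverse norm_of_real by simp
  also have "\<dots> = ((\<rho> - 1) + (1 - 1 / \<rho>)) / 4"
    using assms by simp
  also have "1 - 1 / \<rho> < \<rho> - 1"
  proof -
    have "(\<rho> - 1) * (1 / \<rho>) < (\<rho> - 1) * 1"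
      using assms by (intro mult_strict_left_mono) auto
    then show ?thesis using assms by (simp add: field_simps)
  qed
  finally have "dist (joukowski w) (joukowski u) < (\<rho> - 1) / 2" by simp
  moreover have "0 \<le> 1 + cos (Arg w)" using cos_ge_minus_one[of "Arg w"] by linarith
  ultimately show ?thesis
    unfolding D_region_iff u_def joukowski_unit_circle
    using \<open>0 \<le> 1 + cos (Arg w)\<close> by (intro bexI[of _ "(1 + cos (Arg w)) / 2"]) auto
qed

definition ellipse_path :: "real \<Rightarrow> real \<Rightarrow> complex" where
  "ellipse_path \<rho> t = joukowski (of_real \<rho> * exp (2 * of_real pi * \<i> * of_real t))"

lemma ellipse_path_eq:
  assumes "\<rho> > 1"
  shows "ellipse_path \<rho> t = 1/2 + (of_real \<rho> * exp (2 * of_real pi * \<i> * of_real t)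
            + exp (- (2 * of_real pi * \<i> * of_real t)) / of_real \<rho>) / 4"
  using assms by (simp add: ellipse_path_def joukowski_def exp_minus field_simps)

lemma ellipse_path_Complex:
  assumes "\<rho> > 1"
  shows "ellipse_path \<rho> t = Complex (1/2 + (\<rho> + 1/\<rho>) / 4 * cos (2*pi*t)) ((\<rho> - 1/\<rho>) / 4 * sin (2*pi*t))"
proof -
  have "exp (2 * of_real pi * \<i> * of_real t) = cis (2 * pi * t)"
    by (simp add: cis_conv_exp mult_ac)
  moreover have "exp (- (2 * of_real pi * \<i> * of_real t)) = cis (- (2 * pi * t))"
    by (simp add: cis_conv_exp mult_ac)
  ultimately show ?thesis
    unfolding ellipse_path_eq[OF assms]
    by (auto simp: complex_eq_iff algebra_simps add_divide_distrib)
qed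

lemma ellipse_path_vector_derivative:
  assumes "\<rho> > 1"
  shows "(ellipse_path \<rho> has_vector_derivative
     (of_real \<rho> * exp (2 * of_real pi * \<i> * of_real t)
            - exp (- (2 * of_real pi * \<i> * of_real t)) / of_real \<rho>) * (pi * \<i> / 2)) (at t)"
proof -
  have "((\<lambda>z. 1/2 + (of_real \<rho> * exp (2 * of_real pi * \<i> * z)
            + exp (- (2 * of_real pi * \<i> * z)) / of_real \<rho>) / 4) has_field_derivative
     (of_real \<rho> * exp (2 * of_real pi * \<i> * of_real t)
            - exp (- (2 * of_real pi * \<i> * of_real t)) / of_real \<rho>) * (pi * \<i> / 2)) (at (of_real t))"
    using assms by (auto intro!: derivative_eq_intros simp: field_simps)
  from has_vector_derivative_real_field[OF this] show ?thesis
    using ellipse_path_eq[OF assms] by presburger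
qed

lemma valid_path_ellipse_path:
  assumes "\<rho> > 1"
  shows "valid_path (ellipse_path \<rho>)"
proof -
  have "ellipse_path \<rho> C1_differentiable_on {0..1}"
    unfolding C1_differentiable_on_def
  proof (intro exI conjI ballI)
    show "continuous_on {0..1} (\<lambda>t. (of_real \<rho> * exp (2 * of_real pi * \<i> * of_real t)
            - exp (- (2 * of_real pi * \<i> * of_real t)) / of_real \<rho>) * (pi * \<i> / 2))"
      using assms by (intro continuous_intros) auto
  qed (rule ellipse_path_vector_derivative[OF assms])
  then show ?thesis
    unfolding valid_path_def by (rule C1_differentiable_imp_piecewise)
qed

lemma path_image_ellipse_path:
  assumes "\<rho> > 1" "z \<in> path_image (ellipse_path \<rho>)"
  obtains w where "cmod w = \<rho>" "z = joukowski w"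
proof -
  obtain t where "z = ellipse_path \<rho> t" using assms by (auto simp: path_image_def)
  moreover have "cmod (of_real \<rho> * exp (2 * of_real pi * \<i> * of_real t)) = \<rho>"
    using assms by (simp add: norm_mult norm_exp_eq_Re)
  ultimately show ?thesis using that by (auto simp: ellipse_path_def)
qed

lemma pathstart_ellipse_path: "pathstart (ellipse_path \<rho>) = joukowski (of_real \<rho>)"
  by (simp add: pathstart_def ellipse_path_def)

lemma pathfinish_ellipse_path: "pathfinish (ellipse_path \<rho>) = joukowski (of_real \<rho>)"
  by (simp add: pathfinish_def ellipse_path_def exp_eq_1)

text \<open>The vertical linear homotopy deforms the ellipse into the circle over its major axis. A point of that
  homotopy is real only when the angle is a multiple of \<open>\<pi>\<close>, that is, at the two vertices, and these
  lie outside \<open>[0,1]\<close>.\<close>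

lemma winding_number_ellipse_path:
  assumes "\<rho> > 1" "x \<in> {0..1}"
  shows "winding_number (ellipse_path \<rho>) (complex_of_real x) = 1"
proof -
  define a where "a = (\<rho> + 1/\<rho>) / 4"
  define c where "c = (\<rho> - 1/\<rho>) / 4"
  have "(\<rho> - 1)\<^sup>2 > 0" using assms by simp
  then have a: "a > 1/2" using assms by (simp add: a_def field_simps power2_eq_square)
  have "1 / \<rho> < 1" using assms by simp
  then have "\<rho> - 1 / \<rho> > 0" using assms by linarith
  then have c: "c > 0" by (simp add: c_def)
  have circ: "circlepath (1/2) a t = Complex (1/2 + a * cos (2*pi*t)) (a * sin (2*pi*t))" for t
  proof -
    have "exp (2 * of_real pi * \<i> * of_real t) = cis (2 * pi * t)"
      by (simp add: cis_conv_exp mult_ac)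
    then show ?thesis by (auto simp: circlepath complex_eq_iff)
  qed
  have "homotopic_loops (- {of_real x}) (ellipse_path \<rho>) (circlepath (1/2) a)"
  proof (rule homotopic_loops_linear)
    fix t :: real
    show "closed_segment (ellipse_path \<rho> t) (circlepath (1/2) a t) \<subseteq> - {of_real x}"
    proof (intro subsetI ComplI)
      fix z assume z: "z \<in> closed_segment (ellipse_path \<rho> t) (circlepath (1/2) a t)" "z \<in> {of_real x}"
      then obtain u where u: "0 \<le> u" "u \<le> 1"
        "of_real x = (1 - u) *\<^sub>R ellipse_path \<rho> t + u *\<^sub>R circlepath (1/2) a t"
        by (auto simp: closed_segment_def)
      have "0 = ((1 - u) * c + u * a) * sin (2*pi*t)"
        using arg_cong[OF u(3), of Im]
        by (simp add: ellipse_path_Complex[OF assms(1)] circ c_def[symmetric] algebra_simps)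
      moreover have "(1 - u) * c + u * a > 0"
        using u a c by (cases "u = 0") (auto intro!: add_nonneg_pos)
      ultimately have "sin (2*pi*t) = 0" by simp
      then have cos: "\<bar>cos (2*pi*t)\<bar> = 1"
        using sin_cos_squared_add[of "2*pi*t"] by (simp add: abs_square_eq_1)
      have "x = 1/2 + a * cos (2*pi*t)"
        using arg_cong[OF u(3), of Re]
        by (simp add: ellipse_path_Complex[OF assms(1)] circ a_def[symmetric] algebra_simps)
      then have "\<bar>x - 1/2\<bar> = a * \<bar>cos (2*pi*t)\<bar>" using a by (simp add: abs_mult)
      with cos have "\<bar>x - 1/2\<bar> = a" by simp
      then show False using a assms(2) by (auto simp: abs_if split: if_splits)
    qed
  qed (use valid_path_ellipse_path[OF assms(1)] valid_path_imp_path in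
       \<open>auto simp: pathstart_ellipse_path pathfinish_ellipse_path\<close>)
  then have "winding_number (ellipse_path \<rho>) (of_real x) = winding_number (circlepath (1/2) a) (of_real x)"
    by (rule winding_number_homotopic_loops)
  also have "\<dots> = 1"
  proof (rule winding_number_circlepath)
    have "complex_of_real x - 1/2 = of_real (x - 1/2)" by simp
    then have "cmod (complex_of_real x - 1/2) = \<bar>x - 1/2\<bar>"
      by (simp only: norm_of_real)
    also have "\<dots> < a" using a assms(2) by (auto simp: abs_if)
    finally show "cmod (complex_of_real x - 1/2) < a" .
  qed
  finally show ?thesis .
qed

text \<open>A Chebyshev polynomial of large degree separates the two sets: its modulus is at most \<open>1\<close> on the
  interval and larger than \<open>1\<close> on the ellipse.\<close>

lemma unit_interval_not_on_ellipse:
  assumes "\<rho> > 1" "x \<in> {0..1}"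
  shows "complex_of_real x \<notin> path_image (ellipse_path \<rho>)"
proof
  assume "complex_of_real x \<in> path_image (ellipse_path \<rho>)"
  then obtain w where w: "cmod w = \<rho>" "of_real x = joukowski w"
    using path_image_ellipse_path[OF assms(1)] by blast
  obtain n where n: "2 / (1 - 1 / \<rho>) < \<rho> ^ n" using assms(1) real_arch_pow by blast
  have "2 / (1 - 1 / \<rho>) < \<rho> ^ Suc n"
    using n assms by (smt (verit) power_strict_increasing_iff lessI)
  then have "1 < \<rho> ^ Suc n * ((1 - 1 / \<rho>) / 2)"
    using assms by (subst (asm) pos_divide_less_eq) auto
  then show False
    using cmod_cheb01_ge[OF w(1) assms(1), of "Suc n"] cmod_cheb01_le_1[OF assms(2), of "Suc n"] w
    by simp
qed

section \<open>Polynomial approximation at the Bernstein rate\<close>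

text \<open>The divided difference of a polynomial \<open>\<omega>\<close> is a polynomial in \<open>x\<close> of degree below \<open>degree \<omega>\<close>, and
  integrating against \<open>h(z) dz\<close> only acts on its coefficients. The induction peels off one coefficient,
  using \<open>(z q(z) - x q(x)) / (z - x) = q(z) + x (q(z) - q(x)) / (z - x)\<close>. Vanishing of the
  coefficients from \<open>degree \<omega>\<close> on, rather than a degree bound, makes the case of constant \<open>\<omega>\<close>
  fit into the induction.\<close>

lemma divided_difference_contour_integral:
  fixes \<omega> :: "complex poly"
  assumes "open S" "h holomorphic_on S" "valid_path \<gamma>" "path_image \<gamma> \<subseteq> S"
  shows "\<exists>P. (\<forall>i\<ge>degree \<omega>. coeff P i = 0) \<and> (\<forall>x. x \<notin> path_image \<gamma> \<longrightarrow>
     ((\<lambda>z. (poly \<omega> z - poly \<omega> x) / (z - x) * h z) has_contour_integral poly P x) \<gamma>)"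
proof (induction \<omega>)
  case 0
  show ?case by (intro exI[of _ 0]) (simp add: has_contour_integral_0)
next
  case (pCons a q)
  show ?case
  proof (cases "q = 0")
    case True
    then show ?thesis by (intro exI[of _ 0]) (simp add: has_contour_integral_0)
  next
    case False
    obtain Q where Q: "\<And>i. i \<ge> degree q \<Longrightarrow> coeff Q i = 0"
      and int: "\<And>x. x \<notin> path_image \<gamma> \<Longrightarrow>
        ((\<lambda>z. (poly q z - poly q x) / (z - x) * h z) has_contour_integral poly Q x) \<gamma>"
      using pCons.IH by blast
    have "(\<lambda>z. poly q z * h z) contour_integrable_on \<gamma>"
      using assms by (intro contour_integrable_holomorphic_simple[of _ S] holomorphic_intros) auto
    then obtain c where c: "((\<lambda>z. poly q z * h z) has_contour_integral c) \<gamma>"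
      by (auto simp: contour_integrable_on_def)
    show ?thesis
    proof (intro exI[of _ "pCons c Q"] conjI allI impI)
      fix i assume "i \<ge> degree (pCons a q)"
      then show "coeff (pCons c Q) i = 0"
        using False Q by (cases i) auto
    next
      fix x assume x: "x \<notin> path_image \<gamma>"
      have "((\<lambda>z. poly q z * h z + x * ((poly q z - poly q x) / (z - x) * h z))
          has_contour_integral c + x * poly Q x) \<gamma>"
        by (intro has_contour_integral_add has_contour_integral_lmul c int x)
      then have "((\<lambda>z. (poly (pCons a q) z - poly (pCons a q) x) / (z - x) * h z)
          has_contour_integral c + x * poly Q x) \<gamma>"
      proof (rule has_contour_integral_eq)
        fix z assume "z \<in> path_image \<gamma>"
        with x have "z - x \<noteq> 0" by auto
        then show "poly q z * h z + x * ((poly q z - poly q x) / (z - x) * h z)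
            = (poly (pCons a q) z - poly (pCons a q) x) / (z - x) * h z"
          by (simp add: field_simps)
      qed
      then show "((\<lambda>z. (poly (pCons a q) z - poly (pCons a q) x) / (z - x) * h z)
          has_contour_integral poly (pCons c Q) x) \<gamma>" by simp
    qed
  qed
qed

text \<open>The factor \<open>pi * \<rho>\<close> is a crude bound for the speed of the parametrization, hence for the length of
  the ellipse.\<close>

lemma has_contour_integral_ellipse_bound:
  assumes "\<rho> > 1" "(g has_contour_integral I) (ellipse_path \<rho>)" "B \<ge> 0"
    and "\<And>z. z \<in> path_image (ellipse_path \<rho>) \<Longrightarrow> cmod (g z) \<le> B"
  shows "cmod I \<le> B * (pi * \<rho>)"
proof -
  have "((\<lambda>t. g (ellipse_path \<rho> t) * vector_derivative (ellipse_path \<rho>) (at t)) has_integral I) (cbox 0 1)"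
    using assms(2) by (simp add: has_contour_integral)
  moreover have "cmod (g (ellipse_path \<rho> t) * vector_derivative (ellipse_path \<rho>) (at t)) \<le> B * (pi * \<rho>)"
    if "t \<in> cbox 0 1" for t
  proof -
    have "cmod (of_real \<rho> * exp (2 * of_real pi * \<i> * of_real t)
            - exp (- (2 * of_real pi * \<i> * of_real t)) / of_real \<rho>) \<le> \<rho> + 1 / \<rho>"
      using assms(1) by (intro order_trans[OF norm_triangle_ineq4]) (simp add: norm_mult norm_divide)
    also have "\<dots> \<le> \<rho> + \<rho>"
      using assms(1) by (intro add_left_mono) (simp add: divide_le_eq mult_ge1_I)
    finally have "cmod (of_real \<rho> * exp (2 * of_real pi * \<i> * of_real t)
            - exp (- (2 * of_real pi * \<i> * of_real t)) / of_real \<rho>) * (pi / 2) \<le> (\<rho> + \<rho>) * (pi / 2)"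
      by (intro mult_right_mono) auto
    then have "cmod (vector_derivative (ellipse_path \<rho>) (at t)) \<le> pi * \<rho>"
      unfolding vector_derivative_at[OF ellipse_path_vector_derivative[OF assms(1)]] norm_mult
      by (simp add: norm_mult norm_divide algebra_simps)
    then show ?thesis
      unfolding norm_mult using assms(3,4) that by (intro mult_mono) (auto simp: path_image_def)
  qed
  moreover have "0 \<le> B * (pi * \<rho>)" using assms by simp
  ultimately have "cmod I \<le> B * (pi * \<rho>) * Henstock_Kurzweil_Integration.content (cbox 0 (1::real))"
    by (intro has_integral_bound)
  then show ?thesis by simp
qed

text \<open>Hermite interpolation at the Chebyshev nodes, in its contour integral form. With \<open>\<omega>\<close> the Chebyshev
  polynomial of degree \<open>n\<close> and \<open>\<gamma>\<close> the ellipse,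
  \<open>P(x) = 1/(2 pi i) \<integral>\<^sub>\<gamma> (\<omega>(z) - \<omega>(x))/(z - x) F(z)/\<omega>(z) dz\<close> is a polynomial in \<open>x\<close> of degree below
  \<open>n\<close>. Subtracting it from the Cauchy formula for \<open>F(x)\<close> leaves the remainder
  \<open>1/(2 pi i) \<integral>\<^sub>\<gamma> \<omega>(x) F(z) / (\<omega>(z) (z - x)) dz\<close>, whose integrand is of size \<open>\<rho>^(-n)\<close> because
  \<open>\<bar>\<omega>(x)\<bar> \<le> 1\<close> and \<open>\<bar>\<omega>(z)\<bar>\<close> grows like \<open>\<rho>^n\<close>.\<close>

lemma bernstein_approximation:
  assumes "\<rho> > 1" "F holomorphic_on D_region \<rho>"
  shows "\<exists>A\<ge>0. \<forall>n\<ge>1. \<exists>P. degree P < n \<and>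
    (\<forall>x\<in>{0..1}. cmod (F (complex_of_real x) - poly P (complex_of_real x)) \<le> A / \<rho> ^ n)"
proof -
  let ?\<gamma> = "ellipse_path \<rho>"
  let ?I = "complex_of_real ` {0..1}"
  have \<gamma>D: "path_image ?\<gamma> \<subseteq> D_region \<rho>"
    using path_image_ellipse_path[OF assms(1)] joukowski_in_D_region[OF _ assms(1)] by blast
  have comp: "compact (path_image ?\<gamma>)"
    using valid_path_ellipse_path[OF assms(1)] compact_valid_path_image by blast
  have "continuous_on (path_image ?\<gamma>) F"
    using assms(2) \<gamma>D holomorphic_on_imp_continuous_on holomorphic_on_subset by blast
  then have "bounded (F ` path_image ?\<gamma>)"
    using comp compact_continuous_image compact_imp_bounded by blast
  then obtain B where B: "B > 0" "\<And>z. z \<in> path_image ?\<gamma> \<Longrightarrow> cmod (F z) \<le> B"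
    unfolding bounded_pos by auto
  have "compact ?I"
    by (intro compact_continuous_image continuous_intros) auto
  moreover have "path_image ?\<gamma> \<inter> ?I = {}"
    using unit_interval_not_on_ellipse[OF assms(1)] by blast
  ultimately have \<delta>pos: "setdist (path_image ?\<gamma>) ?I > 0"
    using setdist_gt_0_compact_closed[OF comp compact_imp_closed] by (auto simp: path_image_nonempty)
  define \<delta> where "\<delta> = setdist (path_image ?\<gamma>) ?I"
  define \<kappa> where "\<kappa> = (1 - 1 / \<rho>) / 2"
  have \<kappa>: "\<kappa> > 0" using assms(1) by (simp add: \<kappa>_def)
  define A where "A = B / (\<kappa> * \<delta>) * (pi * \<rho>) / (2 * pi)"
  show ?thesis
  proof (intro exI[of _ A] conjI allI impI)
    show "A \<ge> 0" using B \<kappa> \<delta>pos assms(1) by (simp add: A_def \<delta>_def)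
    fix n :: nat assume n: "n \<ge> 1"
    let ?\<omega> = "cheb01 n"
    have \<omega>: "cmod (poly ?\<omega> z) \<ge> \<rho> ^ n * \<kappa>" if "z \<in> path_image ?\<gamma>" for z
      using path_image_ellipse_path[OF assms(1) that] cmod_cheb01_ge[OF _ assms(1) n]
      unfolding \<kappa>_def by metis
    have pos: "\<rho> ^ n * \<kappa> > 0" using assms(1) \<kappa> by simp
    have \<omega>0: "poly ?\<omega> z \<noteq> 0" if "z \<in> path_image ?\<gamma>" for z
      using \<omega>[OF that] pos by auto
    define S where "S = D_region \<rho> \<inter> {z. poly ?\<omega> z \<noteq> 0}"
    \<comment> \<open>the zeros of \<open>\<omega>\<close> lie off the ellipse; removing them makes the weight \<open>F/\<omega>\<close> holomorphic\<close>
    have "open S" unfolding S_def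
      by (intro open_Int open_D_region open_Collect_neq continuous_intros)
    moreover have "(\<lambda>z. F z / poly ?\<omega> z) holomorphic_on S"
      using assms(2) by (intro holomorphic_intros) (auto simp: S_def intro: holomorphic_on_subset)
    moreover have "path_image ?\<gamma> \<subseteq> S" using \<gamma>D \<omega>0 by (auto simp: S_def)
    ultimately obtain Q where Q: "\<And>i. i \<ge> degree ?\<omega> \<Longrightarrow> coeff Q i = 0"
      and int: "\<And>x. x \<notin> path_image ?\<gamma> \<Longrightarrow> ((\<lambda>z. (poly ?\<omega> z - poly ?\<omega> x) / (z - x) * (F z / poly ?\<omega> z))
          has_contour_integral poly Q x) ?\<gamma>"
      using divided_difference_contour_integral[of S "\<lambda>z. F z / poly ?\<omega> z" ?\<gamma> ?\<omega>]
        valid_path_ellipse_path[OF assms(1)] by blast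
    define P where "P = smult (1 / (2 * of_real pi * \<i>)) Q"
    have "degree Q < n"
      using n Q degree_cheb01[of n] by (intro degree_lessI) auto
    then have "degree P < n" by (simp add: P_def)
    moreover have "cmod (F x - poly P x) \<le> A / \<rho> ^ n" if "r \<in> {0..1}" "x = complex_of_real r" for x r
    proof -
      have x: "x \<notin> path_image ?\<gamma>" using unit_interval_not_on_ellipse[OF assms(1)] that by blast
      have "x \<in> D_region \<rho>" using unit_interval_subset_D_region assms(1) that by simp
      then have "((\<lambda>z. F z / (z - x)) has_contour_integral (2 * pi * \<i> * winding_number ?\<gamma> x * F x)) ?\<gamma>"
        using assms \<gamma>D x valid_path_ellipse_path[OF assms(1)]
        by (intro Cauchy_integral_formula_convex_simple[OF convex_D_region])
           (auto simp: interior_open[OF open_D_region] pathstart_ellipse_path pathfinish_ellipse_path)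
      then have "((\<lambda>z. F z / (z - x)) has_contour_integral (2 * pi * \<i> * F x)) ?\<gamma>"
        using winding_number_ellipse_path[OF assms(1)] that by simp
      from has_contour_integral_diff[OF this int[OF x]]
      have "((\<lambda>z. poly ?\<omega> x * F z / (poly ?\<omega> z * (z - x))) has_contour_integral
              (2 * pi * \<i> * F x - poly Q x)) ?\<gamma>"
      proof (rule has_contour_integral_eq)
        fix z assume "z \<in> path_image ?\<gamma>"
        then have "z - x \<noteq> 0" "poly ?\<omega> z \<noteq> 0" using x \<omega>0 by auto
        then show "F z / (z - x) - (poly ?\<omega> z - poly ?\<omega> x) / (z - x) * (F z / poly ?\<omega> z)
            = poly ?\<omega> x * F z / (poly ?\<omega> z * (z - x))"
          by (simp add: divide_simps) (simp add: algebra_simps)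
      qed
      then have "cmod (2 * pi * \<i> * F x - poly Q x) \<le> B / (\<rho> ^ n * \<kappa> * \<delta>) * (pi * \<rho>)"
      proof (rule has_contour_integral_ellipse_bound[OF assms(1)])
        show "0 \<le> B / (\<rho> ^ n * \<kappa> * \<delta>)" using B pos \<delta>pos by (simp add: \<delta>_def)
        fix z assume z: "z \<in> path_image ?\<gamma>"
        have "\<delta> \<le> cmod (z - x)"
          unfolding \<delta>_def dist_norm[symmetric] using z that by (intro setdist_le_dist) auto
        then have "\<rho> ^ n * \<kappa> * \<delta> \<le> cmod (poly ?\<omega> z) * cmod (z - x)"
          using \<omega>[OF z] pos \<delta>pos by (intro mult_mono) (auto simp: \<delta>_def)
        moreover have "cmod (poly ?\<omega> x) * cmod (F z) \<le> 1 * B"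
          using cmod_cheb01_le_1[OF that(1)] that B z by (intro mult_mono) auto
        ultimately show "cmod (poly ?\<omega> x * F z / (poly ?\<omega> z * (z - x))) \<le> B / (\<rho> ^ n * \<kappa> * \<delta>)"
          unfolding norm_divide norm_mult using B pos \<delta>pos
          by (intro frac_le) (auto simp: \<delta>_def)
      qed
      then have "cmod (2 * pi * \<i> * F x - poly Q x) / (2 * pi) \<le> A / \<rho> ^ n"
        by (simp add: A_def field_simps)
      moreover have "F x - poly P x = (2 * pi * \<i> * F x - poly Q x) / (2 * pi * \<i>)"
        by (simp add: P_def field_simps)
      then have "cmod (F x - poly P x) = cmod (2 * pi * \<i> * F x - poly Q x) / (2 * pi)"
        by (simp only: norm_divide norm_mult norm_of_real norm_ii norm_numeral) simp
      ultimately show ?thesis by simp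
    qed
    ultimately show "\<exists>P. degree P < n \<and>
        (\<forall>x\<in>{0..1}. cmod (F (complex_of_real x) - poly P (complex_of_real x)) \<le> A / \<rho> ^ n)"
      by blast
  qed
qed

section \<open>Equidistant Lagrange interpolation\<close>

text \<open>The denominator is \<open>m + 1\<close> rather than \<open>m\<close>, so that all nodes lie in the half-open interval
  \<open>[0,1)\<close> and \<open>m = 0\<close> needs no separate treatment.\<close>

definition interp_node :: "nat \<Rightarrow> nat \<Rightarrow> real" where
  "interp_node m i = real i / real (m + 1)"

definition lagrange_poly :: "nat \<Rightarrow> nat \<Rightarrow> real poly" where
  "lagrange_poly m i = (\<Prod>j\<in>{..m} - {i}.
     smult (1 / (interp_node m i - interp_node m j)) [:- interp_node m j, 1:])"

lemma interp_node_eq_iff [simp]: "interp_node m i = interp_node m j \<longleftrightarrow> i = j"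
  by (simp add: interp_node_def field_simps del: of_nat_Suc)

lemma interp_node_in_unit: "i \<le> m \<Longrightarrow> interp_node m i \<in> {0..<1}"
  by (simp add: interp_node_def)

lemma degree_lagrange_poly:
  assumes "i \<le> m"
  shows "degree (lagrange_poly m i) \<le> m"
proof -
  have "degree (lagrange_poly m i) \<le> sum (degree \<circ>
      (\<lambda>j. smult (1 / (interp_node m i - interp_node m j)) [:- interp_node m j, 1:])) ({..m} - {i})"
    unfolding lagrange_poly_def by (rule degree_prod_sum_le) simp
  also have "\<dots> \<le> (\<Sum>j\<in>{..m} - {i}. 1)"
    by (rule sum_mono) simp
  finally show ?thesis using assms by simp
qed

lemma poly_lagrange_poly_node:
  assumes "i \<le> m" "k \<le> m"
  shows "poly (lagrange_poly m i) (interp_node m k) = (if k = i then 1 else 0)"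
proof (cases "k = i")
  case True
  then show ?thesis
    by (auto simp: lagrange_poly_def poly_prod diff_divide_distrib[symmetric] intro!: prod.neutral)
next
  case False
  then show ?thesis
    using assms by (auto simp: lagrange_poly_def poly_prod intro!: prod_zero bexI[of _ k])
qed

lemma lagrange_interpolation_reproduces:
  assumes "degree p \<le> m"
  shows "(\<Sum>i\<le>m. smult (poly p (interp_node m i)) (lagrange_poly m i)) = p" (is "?q = p")
proof -
  have card: "card (interp_node m ` {..m}) = Suc m"
    by (subst card_image) (auto simp: inj_on_def)
  have "degree ?q \<le> m"
    by (intro degree_sum_le order_trans[OF degree_smult_le] degree_lagrange_poly) auto
  moreover have "poly ?q x = poly p x" if x: "x \<in> interp_node m ` {..m}" for x
  proof -
    obtain k where "k \<le> m" "x = interp_node m k" using x by auto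
    then have "poly ?q x = (\<Sum>i\<le>m. if k = i then poly p (interp_node m i) else 0)"
      unfolding poly_sum by (intro sum.cong) (auto simp: poly_lagrange_poly_node)
    also have "\<dots> = poly p x" using \<open>k \<le> m\<close> \<open>x = _\<close> by simp
    finally show ?thesis .
  qed
  ultimately show ?thesis
    using assms card by (intro poly_eqI_degree[of "interp_node m ` {..m}"]) auto
qed

section \<open>Networks realizing piecewise interpolants\<close>

text \<open>A product of matrices written out as a sum over index paths, in the shape in which \<open>contraction\<close>
  presents it once the digits are held fixed. The vector \<open>h\<close> is the right boundary.\<close>

definition chain_sum :: "nat \<Rightarrow> (nat \<Rightarrow> real) \<Rightarrow> (nat \<Rightarrow> nat \<Rightarrow> nat \<Rightarrow> real) \<Rightarrow> nat \<Rightarrow> (nat \<Rightarrow> real) \<Rightarrow> real" where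
  "chain_sum R a M d h =
     (\<Sum>k\<in>(\<Pi>\<^sub>E \<nu>\<in>{1..d}. {1..R}). a (k 1) * (\<Prod>\<nu>=2..d. M \<nu> (k (\<nu> - 1)) (k \<nu>)) * h (k d))"

lemma sum_PiE_Suc:
  fixes G :: "(nat \<Rightarrow> nat) \<Rightarrow> real"
  shows "(\<Sum>k\<in>(\<Pi>\<^sub>E \<nu>\<in>{1..Suc d}. {1..R}). G k)
    = (\<Sum>g\<in>(\<Pi>\<^sub>E \<nu>\<in>{1..d}. {1..R}). \<Sum>l=1..R. G (g(Suc d := l)))"
proof -
  have "{1..Suc d} = insert (Suc d) {1..d}" by auto
  then have "(\<Sum>k\<in>(\<Pi>\<^sub>E \<nu>\<in>{1..Suc d}. {1..R}). G k)
      = (\<Sum>k\<in>(\<lambda>(l, g). g(Suc d := l)) ` ({1..R} \<times> (\<Pi>\<^sub>E \<nu>\<in>{1..d}. {1..R})). G k)"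
    by (simp only: PiE_insert_eq)
  also have "\<dots> = (\<Sum>(l, g)\<in>{1..R} \<times> (\<Pi>\<^sub>E \<nu>\<in>{1..d}. {1..R}). G (g(Suc d := l)))"
    using inj_combinator[of "Suc d" "{1..d}" "\<lambda>_. {1..R}"]
    by (subst sum.reindex) (simp_all add: case_prod_unfold)
  also have "\<dots> = (\<Sum>l=1..R. \<Sum>g\<in>(\<Pi>\<^sub>E \<nu>\<in>{1..d}. {1..R}). G (g(Suc d := l)))"
    by (rule sum.cartesian_product[symmetric])
  also have "\<dots> = (\<Sum>g\<in>(\<Pi>\<^sub>E \<nu>\<in>{1..d}. {1..R}). \<Sum>l=1..R. G (g(Suc d := l)))"
    by (rule sum.swap)
  finally show ?thesis .
qed

lemma chain_sum_1: "chain_sum R a M (Suc 0) h = (\<Sum>k=1..R. a k * h k)"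
proof -
  have "chain_sum R a M (Suc 0) h
      = (\<Sum>g\<in>(\<Pi>\<^sub>E \<nu>\<in>{1..0::nat}. {1..R}). \<Sum>l=1..R. a l * h l)"
    unfolding chain_sum_def by (subst sum_PiE_Suc) simp
  then show ?thesis by simp
qed

text \<open>Absorbing the last matrix into the right boundary vector.\<close>

lemma chain_sum_Suc:
  assumes "d \<ge> 1"
  shows "chain_sum R a M (Suc d) h = chain_sum R a M d (\<lambda>k. \<Sum>l=1..R. M (Suc d) k l * h l)"
proof -
  have "a ((g(Suc d := l)) 1) * (\<Prod>\<nu>=2..Suc d. M \<nu> ((g(Suc d := l)) (\<nu> - 1)) ((g(Suc d := l)) \<nu>))
          * h ((g(Suc d := l)) (Suc d))
      = a (g 1) * (\<Prod>\<nu>=2..d. M \<nu> (g (\<nu> - 1)) (g \<nu>)) * (M (Suc d) (g d) l * h l)" for g l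
  proof -
    have "(\<Prod>\<nu>=2..Suc d. M \<nu> ((g(Suc d := l)) (\<nu> - 1)) ((g(Suc d := l)) \<nu>))
        = (\<Prod>\<nu>=2..d. M \<nu> ((g(Suc d := l)) (\<nu> - 1)) ((g(Suc d := l)) \<nu>)) * M (Suc d) (g d) l"
      using assms by (subst prod.nat_ivl_Suc') auto
    also have "(\<Prod>\<nu>=2..d. M \<nu> ((g(Suc d := l)) (\<nu> - 1)) ((g(Suc d := l)) \<nu>))
        = (\<Prod>\<nu>=2..d. M \<nu> (g (\<nu> - 1)) (g \<nu>))"
      by (intro prod.cong) auto
    finally have "(\<Prod>\<nu>=2..Suc d. M \<nu> ((g(Suc d := l)) (\<nu> - 1)) ((g(Suc d := l)) \<nu>))
        = (\<Prod>\<nu>=2..d. M \<nu> (g (\<nu> - 1)) (g \<nu>)) * M (Suc d) (g d) l" .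
    moreover have "(g(Suc d := l)) 1 = g 1" "(g(Suc d := l)) (Suc d) = l" using assms by auto
    ultimately show ?thesis by (simp only: mult.assoc)
  qed
  then show ?thesis
    unfolding chain_sum_def sum_PiE_Suc by (simp only: sum_distrib_left)
qed

lemma chain_sum_cong:
  assumes "d \<ge> 1" "\<And>k. 1 \<le> k \<Longrightarrow> k \<le> R \<Longrightarrow> h k = h' k"
  shows "chain_sum R a M d h = chain_sum R a M d h'"
  unfolding chain_sum_def using assms by (intro sum.cong refl) (auto simp: PiE_iff)

lemma chain_sum_linear:
  "chain_sum R a M d (\<lambda>k. \<Sum>i\<in>I. c i * h i k) = (\<Sum>i\<in>I. c i * chain_sum R a M d (h i))"
  unfolding chain_sum_def sum_distrib_left
  by (subst sum.swap) (simp add: mult_ac)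

text \<open>The matrix of the substitution \<open>t \<mapsto> (i + t)/b\<close> in the monomial basis: by the binomial theorem,
  \<open>((i + t)/b)^l\<close> has the coefficient \<open>digit_shift b i l l'\<close> at \<open>t^l'\<close>. It vanishes for \<open>l' > l\<close>, so
  it preserves the space of polynomials of degree less than \<open>R\<close>.\<close>

definition digit_shift :: "nat \<Rightarrow> nat \<Rightarrow> nat \<Rightarrow> nat \<Rightarrow> real" where
  "digit_shift b i l l' = real (l choose l') * real i ^ (l - l') / real b ^ l"

lemma digit_shift_power:
  assumes "l < R"
  shows "(\<Sum>k=1..R. digit_shift b i l (k - 1) * t ^ (k - 1)) = ((real i + t) / real b) ^ l"
proof -
  have "(\<Sum>k=1..R. digit_shift b i l (k - 1) * t ^ (k - 1)) = (\<Sum>k<R. digit_shift b i l k * t ^ k)"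
    by (rule sum.reindex_bij_witness[of _ Suc "\<lambda>k. k - 1"]) auto
  also have "\<dots> = (\<Sum>k\<le>l. digit_shift b i l k * t ^ k)"
    using assms by (intro sum.mono_neutral_right) (auto simp: digit_shift_def)
  also have "\<dots> = (t + real i) ^ l / real b ^ l"
    by (simp add: binomial_ring digit_shift_def sum_divide_distrib mult_ac)
  finally show ?thesis by (simp add: power_divide add.commute)
qed

lemma poly_eq_sum_lessThan:
  fixes P :: "real poly"
  assumes "degree P < R"
  shows "poly P x = (\<Sum>l<R. coeff P l * x ^ l)"
  unfolding poly_altdef using assms
  by (intro sum.mono_neutral_left) (auto simp: coeff_eq_0)

text \<open>Reading off one digit of \<open>x\<close> is the substitution \<open>t \<mapsto> (i + t)/b\<close>. So a polynomial of degree less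
  than \<open>R\<close> is evaluated, digit by digit, by a product of \<open>R \<times> R\<close> matrices: this is why rank \<open>R\<close>
  suffices at every depth.\<close>

lemma chain_sum_poly:
  assumes "d \<ge> 1" "degree P < R"
  shows "chain_sum R (\<lambda>k. \<Sum>l<R. coeff P l * digit_shift b (i 1) l (k - 1))
            (\<lambda>\<nu> k l. digit_shift b (i \<nu>) (k - 1) (l - 1)) d (\<lambda>k. t ^ (k - 1))
         = poly P ((\<Sum>k=1..d. real (i k) / real b ^ k) + t / real b ^ d)"
  using assms(1)
proof (induction d arbitrary: t rule: nat_induct_at_least)
  case base
  have "chain_sum R (\<lambda>k. \<Sum>l<R. coeff P l * digit_shift b (i 1) l (k - 1))
            (\<lambda>\<nu> k l. digit_shift b (i \<nu>) (k - 1) (l - 1)) 1 (\<lambda>k. t ^ (k - 1))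
      = (\<Sum>l<R. \<Sum>k=1..R. coeff P l * (digit_shift b (i 1) l (k - 1) * t ^ (k - 1)))"
    unfolding One_nat_def chain_sum_1 sum_distrib_right by (subst sum.swap) (simp add: mult_ac)
  also have "\<dots> = (\<Sum>l<R. coeff P l * ((real (i 1) + t) / real b) ^ l)"
    by (intro sum.cong refl) (simp only: sum_distrib_left[symmetric] lessThan_iff digit_shift_power)
  also have "\<dots> = poly P ((real (i 1) + t) / real b)"
    using assms(2) by (simp add: poly_eq_sum_lessThan)
  finally show ?case by (simp add: add_divide_distrib)
next
  case (Suc d)
  have "chain_sum R (\<lambda>k. \<Sum>l<R. coeff P l * digit_shift b (i 1) l (k - 1))
            (\<lambda>\<nu> k l. digit_shift b (i \<nu>) (k - 1) (l - 1)) (Suc d) (\<lambda>k. t ^ (k - 1))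
      = chain_sum R (\<lambda>k. \<Sum>l<R. coeff P l * digit_shift b (i 1) l (k - 1))
            (\<lambda>\<nu> k l. digit_shift b (i \<nu>) (k - 1) (l - 1)) d
            (\<lambda>k. ((real (i (Suc d)) + t) / real b) ^ (k - 1))"
    unfolding chain_sum_Suc[OF Suc.hyps] using Suc.hyps
    by (intro chain_sum_cong digit_shift_power) auto
  also have "\<dots> = poly P ((\<Sum>k=1..d. real (i k) / real b ^ k) + (real (i (Suc d)) + t) / real b / real b ^ d)"
    by (rule Suc.IH)
  finally show ?case by (simp add: add_divide_distrib add.assoc)
qed

text \<open>On each of the \<open>b^d\<close> intervals of length \<open>b^(-d)\<close> the polynomial \<open>P\<close> is replaced by its Lagrange
  interpolant of degree \<open>m\<close> in the local variable, which is the fractional part of \<open>b^d x\<close>.\<close>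

definition piecewise_interpolant :: "nat \<Rightarrow> nat \<Rightarrow> real poly \<Rightarrow> nat \<Rightarrow> real \<Rightarrow> real" where
  "piecewise_interpolant b m P d x =
     (\<Sum>i\<le>m. poly P ((real_of_int \<lfloor>real b ^ d * x\<rfloor> + interp_node m i) / real b ^ d)
              * poly (lagrange_poly m i) (real b ^ d * x - real_of_int \<lfloor>real b ^ d * x\<rfloor>))"

lemma module_smult_poly: "module (smult :: real \<Rightarrow> real poly \<Rightarrow> real poly)"
  by unfold_locales (simp_all add: smult_add_right smult_add_left)

lemma poly_basis_expansion:
  assumes "poly_basis m \<phi>" "degree p \<le> m"
  obtains c where "p = (\<Sum>q=1..m+1. smult (c q) (\<phi> q))"
proof -
  interpret module "smult :: real \<Rightarrow> real poly \<Rightarrow> real poly" by (rule module_smult_poly)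
  have inj: "inj_on \<phi> {1..m+1}" and span: "span (\<phi> ` {1..m+1}) = {p. degree p \<le> m}"
    using assms(1) by (auto simp: poly_basis_def)
  have "p \<in> range (\<lambda>u. \<Sum>v\<in>\<phi> ` {1..m+1}. smult (u v) v)"
    using span assms(2) span_finite[of "\<phi> ` {1..m+1}"] by auto
  then obtain u where "p = (\<Sum>v\<in>\<phi> ` {1..m+1}. smult (u v) v)" by auto
  then have "p = (\<Sum>q=1..m+1. smult (u (\<phi> q)) (\<phi> q))"
    using inj by (simp only: sum.reindex o_def)
  then show ?thesis by (rule that)
qed

lemma scaled_digit_sum:
  assumes "b \<ge> 1"
  shows "real b ^ d * (\<Sum>k=1..d. real (i k) / real b ^ k)
     = real_of_int (\<Sum>k=1..d. int (i k * b ^ (d - k)))"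
  unfolding sum_distrib_left of_int_sum
proof (intro sum.cong refl)
  fix k assume "k \<in> {1..d}"
  then have "real b ^ d = real b ^ (d - k) * real b ^ k" by (simp flip: power_add)
  then show "real b ^ d * (real (i k) / real b ^ k) = real_of_int (int (i k * b ^ (d - k)))"
    using assms by simp
qed

text \<open>The digit shift matrices carry the monomials \<open>1, t, \<dots>, t^(R-1)\<close> of the local variable to the last
  core, which replaces each of them by its interpolant of degree \<open>m\<close>, expanded in the basis \<open>\<phi>\<close>. By
  linearity the contraction is the interpolant of \<open>P\<close> itself.\<close>

lemma network_realizing_piecewise_interpolant:
  assumes "b \<ge> 1" "d \<ge> 1" "degree P < R" "poly_basis m \<phi>"
  obtains v where "wf_network v" "realizes b m \<phi> v (piecewise_interpolant b m P d)"
    "depth v = d" "rank v = (\<lambda>_. R)"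
proof -
  have "\<forall>i. \<exists>c. i \<le> m \<longrightarrow> lagrange_poly m i = (\<Sum>q=1..m+1. smult (c q) (\<phi> q))"
    using poly_basis_expansion[OF assms(4) degree_lagrange_poly] by metis
  then obtain c where c: "\<And>i. i \<le> m \<Longrightarrow> lagrange_poly m i = (\<Sum>q=1..m+1. smult (c i q) (\<phi> q))"
    by metis
  define v where "v = \<lparr>depth = d, rank = (\<lambda>_. R),
    first_core = (\<lambda>j k. \<Sum>l<R. coeff P l * digit_shift b j l (k - 1)),
    mid_core = (\<lambda>\<nu> j k l. digit_shift b j (k - 1) (l - 1)),
    last_core = (\<lambda>k q. \<Sum>i\<le>m. interp_node m i ^ (k - 1) * c i q)\<rparr>"
  have "wf_network v" using assms by (simp add: wf_network_def v_def)
  moreover have "realizes b m \<phi> v (piecewise_interpolant b m P d)"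
    unfolding realizes_def
  proof (intro allI impI)
    fix i :: "nat \<Rightarrow> nat" and y :: real assume y: "y \<in> {0..<1}"
    let ?a = "\<lambda>k. \<Sum>l<R. coeff P l * digit_shift b (i 1) l (k - 1)"
    let ?M = "\<lambda>\<nu> k l. digit_shift b (i \<nu>) (k - 1) (l - 1)"
    let ?s = "\<Sum>k=1..d. real (i k) / real b ^ k"
    have last: "(\<Sum>q=1..m+1. last_core v k q * poly (\<phi> q) y)
        = (\<Sum>j\<le>m. poly (lagrange_poly m j) y * interp_node m j ^ (k - 1))" for k
    proof -
      have "(\<Sum>q=1..m+1. last_core v k q * poly (\<phi> q) y)
          = (\<Sum>j\<le>m. interp_node m j ^ (k - 1) * (\<Sum>q=1..m+1. c j q * poly (\<phi> q) y))"
        unfolding v_def tensor_network.simps sum_distrib_right sum_distrib_left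
        by (subst sum.swap) (simp only: mult.assoc)
      also have "\<dots> = (\<Sum>j\<le>m. interp_node m j ^ (k - 1) * poly (lagrange_poly m j) y)"
        by (intro sum.cong refl) (simp add: c poly_sum)
      finally show ?thesis by (simp add: mult_ac)
    qed
    have "contraction m \<phi> v i y = chain_sum R ?a ?M d (\<lambda>k. \<Sum>q=1..m+1. last_core v k q * poly (\<phi> q) y)"
      unfolding contraction_def chain_sum_def sum_distrib_left
      by (simp add: v_def mult.assoc)
    also have "\<dots> = (\<Sum>j\<le>m. poly (lagrange_poly m j) y * chain_sum R ?a ?M d (\<lambda>k. interp_node m j ^ (k - 1)))"
      unfolding last by (rule chain_sum_linear)
    also have "\<dots> = (\<Sum>j\<le>m. poly (lagrange_poly m j) y * poly P (?s + interp_node m j / real b ^ d))"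
      by (simp only: chain_sum_poly[OF assms(2,3)])
    finally have contr: "contraction m \<phi> v i y
      = (\<Sum>j\<le>m. poly (lagrange_poly m j) y * poly P (?s + interp_node m j / real b ^ d))" .
    obtain N where N: "real b ^ d * ?s = real_of_int N"
      using scaled_digit_sum[OF assms(1)] by blast
    have b: "real b ^ d > 0" using assms(1) by simp
    have Ny: "real b ^ d * (?s + y / real b ^ d) = real_of_int N + y"
      unfolding distrib_left N using b by simp
    have fl: "\<lfloor>real_of_int N + y\<rfloor> = N" using y by (simp add: floor_eq_iff)
    have sN: "?s + t / real b ^ d = (real_of_int N + t) / real b ^ d" for t
      unfolding N[symmetric] using b by (simp add: field_simps)
    show "tensorize b (depth v) (piecewise_interpolant b m P d) i y = contraction m \<phi> v i y"
      unfolding contr tensorize_def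
      by (simp only: v_def tensor_network.simps piecewise_interpolant_def Ny fl)
         (simp only: sN add_diff_cancel_left' mult.commute)
  qed
  ultimately show ?thesis by (intro that) (auto simp: v_def)
qed

section \<open>Error of the piecewise interpolants\<close>

lemma poly_map_poly_Re: "poly (map_poly Re p) x = Re (poly p (complex_of_real x))"
  by (induction p rule: pCons_induct) (simp_all add: map_poly_pCons)

lemma degree_map_poly_Re_le: "degree (map_poly Re p) \<le> degree p"
  by (rule degree_le) (simp add: coeff_map_poly coeff_eq_0)

text \<open>Uniformity in the centre \<open>x0\<close> is what lets one constant serve all \<open>b^d\<close> intervals.\<close>

lemma real_taylor_uniform:
  assumes "open U" "complex_of_real ` {0..1} \<subseteq> U" "F holomorphic_on U"
  shows "\<exists>T\<ge>0. \<forall>x0\<in>{0..1}. \<exists>p. degree p \<le> m \<and>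
    (\<forall>x\<in>{0..1}. \<bar>Re (F (complex_of_real x)) - poly p (x - x0)\<bar> \<le> T * \<bar>x - x0\<bar> ^ Suc m)"
proof -
  let ?I = "complex_of_real ` {0..1}"
  have hol: "(deriv ^^ i) F holomorphic_on U" for i
    using assms holomorphic_higher_deriv by blast
  have "compact ((deriv ^^ Suc m) F ` ?I)"
    using hol[of "Suc m"] assms(2) holomorphic_on_imp_continuous_on continuous_on_subset
    by (intro compact_continuous_image[of ?I] compact_continuous_image[of "{0..1}"] continuous_intros)
       blast+
  then have "bounded ((deriv ^^ Suc m) F ` ?I)" by (rule compact_imp_bounded)
  then obtain T0 where T0: "T0 > 0" "\<And>z. z \<in> ?I \<Longrightarrow> cmod ((deriv ^^ Suc m) F z) \<le> T0"
    unfolding bounded_pos by auto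
  have conv: "convex ?I"
    by (intro convex_linear_image convex_real_interval) (simp add: bounded_linear.linear bounded_linear_of_real)
  show ?thesis
  proof (intro exI[of _ "T0 / fact m"] conjI ballI)
    show "0 \<le> T0 / fact m" using T0 by simp
    fix x0 :: real assume x0: "x0 \<in> {0..1}"
    define p where "p = (\<Sum>i\<le>m. monom ((deriv ^^ i) F (of_real x0) / fact i) i)"
    have taylor: "cmod (F (of_real x) - poly p (of_real (x - x0))) \<le> T0 / fact m * \<bar>x - x0\<bar> ^ Suc m"
      if "x \<in> {0..1}" for x
    proof -
      have "cmod ((deriv ^^ 0) F (of_real x)
              - (\<Sum>i\<le>m. (deriv ^^ i) F (of_real x0) * (of_real x - of_real x0) ^ i / fact i))
          \<le> T0 * cmod (of_real x - of_real x0) ^ Suc m / fact m"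
      proof (rule complex_Taylor[of ?I])
        fix i z assume "z \<in> ?I" "i \<le> m"
        then show "((deriv ^^ i) F has_field_derivative (deriv ^^ Suc i) F z) (at z within ?I)"
          using holomorphic_derivI[OF hol[of i] assms(1), of z] assms(2)
          by (auto intro: has_field_derivative_at_within)
      qed (use conv T0 x0 that in auto)
      moreover have "cmod (complex_of_real x - of_real x0) = \<bar>x - x0\<bar>"
        by (metis norm_of_real of_real_diff)
      ultimately show ?thesis
        by (simp add: p_def poly_sum poly_monom mult_ac)
    qed
    show "\<exists>p. degree p \<le> m \<and>
      (\<forall>x\<in>{0..1}. \<bar>Re (F (complex_of_real x)) - poly p (x - x0)\<bar> \<le> T0 / fact m * \<bar>x - x0\<bar> ^ Suc m)"
    proof (intro exI[of _ "map_poly Re p"] conjI ballI)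
      have "degree p \<le> m" unfolding p_def
        by (intro degree_sum_le order_trans[OF degree_monom_le]) auto
      then show "degree (map_poly Re p) \<le> m"
        using degree_map_poly_Re_le[of p] by simp
      fix x :: real assume "x \<in> {0..1}"
      from taylor[OF this] show "\<bar>Re (F (complex_of_real x)) - poly (map_poly Re p) (x - x0)\<bar>
          \<le> T0 / fact m * \<bar>x - x0\<bar> ^ Suc m"
        unfolding poly_map_poly_Re minus_complex.simps(1)[symmetric]
        by (rule order_trans[OF abs_Re_le_cmod])
    qed
  qed
qed

lemma lebesgue_function_bounded:
  "\<exists>L\<ge>0. \<forall>y\<in>{0..1}. (\<Sum>i\<le>m. \<bar>poly (lagrange_poly m i) y\<bar>) \<le> L"
proof -
  have "compact ((\<lambda>y. \<Sum>i\<le>m. \<bar>poly (lagrange_poly m i) y\<bar>) ` {0..1})"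
    by (intro compact_continuous_image continuous_intros) auto
  then have "\<exists>L. \<forall>y\<in>{0..1}. (\<Sum>i\<le>m. \<bar>poly (lagrange_poly m i) y\<bar>) \<le> L"
    by (auto dest!: compact_imp_bounded simp: bounded_real)
  then obtain L where L: "\<And>y. y \<in> {0..1} \<Longrightarrow> (\<Sum>i\<le>m. \<bar>poly (lagrange_poly m i) y\<bar>) \<le> L"
    by blast
  have "0 \<le> (\<Sum>i\<le>m. \<bar>poly (lagrange_poly m i) 0\<bar>)" by (intro sum_nonneg) simp
  also have "\<dots> \<le> L" by (rule L) simp
  finally show ?thesis using L by blast
qed

text \<open>Interpolation only sees the values of \<open>P\<close> at the nodes, and there \<open>P\<close> is within \<open>\<epsilon>\<close> of \<open>f\<close>. So it
  is enough that \<open>f\<close> itself has local Taylor polynomials, which interpolation reproduces; this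
  avoids bounding the derivatives of \<open>P\<close> uniformly in its degree. The Lebesgue constant \<open>L\<close> controls how the
  interpolation amplifies the errors at the nodes.\<close>

lemma piecewise_interpolant_error:
  assumes b: "b \<ge> 2" and "L \<ge> 0" "T \<ge> 0" "\<epsilon> \<ge> 0"
    and L: "\<And>y. y \<in> {0..1} \<Longrightarrow> (\<Sum>i\<le>m. \<bar>poly (lagrange_poly m i) y\<bar>) \<le> L"
    and T: "\<And>x0. x0 \<in> {0..<1} \<Longrightarrow> \<exists>p. degree p \<le> m \<and>
      (\<forall>x\<in>{0..<1}. \<bar>f x - poly p (x - x0)\<bar> \<le> T * \<bar>x - x0\<bar> ^ Suc m)"
    and P: "\<And>x. x \<in> {0..<1} \<Longrightarrow> \<bar>f x - poly P x\<bar> \<le> \<epsilon>"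
    and x: "x \<in> {0..<1}"
  shows "\<bar>f x - piecewise_interpolant b m P d x\<bar> \<le> (1 + L) * T / real b ^ (d * Suc m) + L * \<epsilon>"
proof -
  define B where "B = real b ^ d"
  have B: "B > 0" using b by (simp add: B_def)
  define N where "N = \<lfloor>B * x\<rfloor>"
  have N0: "0 \<le> N" using B x by (simp add: N_def)
  have "B * x < B * 1" using B x by (intro mult_strict_left_mono) auto
  then have "real_of_int N < B" unfolding N_def by linarith
  then have "N < int (b ^ d)"
    by (metis B_def of_int_less_iff of_int_of_nat_eq of_nat_power)
  then have "real_of_int (N + 1) \<le> real_of_int (int (b ^ d))" by (simp only: of_int_le_iff)
  then have N1: "real_of_int N + 1 \<le> B" by (simp add: B_def)
  define y where "y = B * x - real_of_int N"
  have y: "y \<in> {0..<1}" unfolding y_def N_def by (simp; linarith)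
  define x0 where "x0 = real_of_int N / B"
  define X where "X t = (real_of_int N + t) / B" for t
  have X: "X t \<in> {0..<1}" "\<bar>X t - x0\<bar> \<le> 1 / B" "X t - x0 = t / B" if "t \<in> {0..<1}" for t
  proof -
    show eq: "X t - x0 = t / B" by (simp add: X_def x0_def add_divide_distrib)
    show "\<bar>X t - x0\<bar> \<le> 1 / B" unfolding eq using B that by (simp add: divide_right_mono)
    have "real_of_int N + t < B" using N1 that by auto
    then show "X t \<in> {0..<1}" using B N0 that by (simp add: X_def)
  qed
  have xX: "x = X y" using B by (simp add: X_def y_def)
  have "x0 \<in> {0..<1}" using X(1)[of 0] by (simp add: X_def x0_def)
  from T[OF this] obtain p where p: "degree p \<le> m"
    and Tp: "\<And>x. x \<in> {0..<1} \<Longrightarrow> \<bar>f x - poly p (x - x0)\<bar> \<le> T * \<bar>x - x0\<bar> ^ Suc m"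
    by blast
  define \<eta> where "\<eta> = T * (1 / B) ^ Suc m"
  have \<eta>0: "\<eta> \<ge> 0" using B assms by (simp add: \<eta>_def)
  have \<eta>: "\<bar>f (X t) - poly p (t / B)\<bar> \<le> \<eta>" if "t \<in> {0..<1}" for t
  proof -
    have "\<bar>f (X t) - poly p (X t - x0)\<bar> \<le> T * \<bar>X t - x0\<bar> ^ Suc m"
      using Tp X[OF that] by blast
    also have "\<dots> \<le> \<eta>" unfolding \<eta>_def
      using X[OF that] assms by (intro mult_left_mono power_mono) auto
    finally show ?thesis using X(3)[OF that] by simp
  qed
  define q where "q = pcompose p [:0, 1 / B:]"
  have q: "poly q t = poly p (t / B)" for t by (simp add: q_def poly_pcompose)
  have "degree q \<le> degree p * degree [:0, 1 / B:]"
    unfolding q_def by (rule degree_pcompose_le)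
  also have "\<dots> \<le> degree p" using B by simp
  finally have "degree q \<le> m" using p by simp
  from arg_cong[OF lagrange_interpolation_reproduces[OF this], of "\<lambda>r. poly r y"]
  have rep: "(\<Sum>i\<le>m. poly p (interp_node m i / B) * poly (lagrange_poly m i) y) = poly p (y / B)"
    by (simp add: poly_sum q)
  have "f x - piecewise_interpolant b m P d x
      = (f (X y) - poly p (y / B))
        + (\<Sum>i\<le>m. (poly p (interp_node m i / B) - poly P (X (interp_node m i))) * poly (lagrange_poly m i) y)"
    unfolding left_diff_distrib sum_subtractf rep
    by (simp add: piecewise_interpolant_def B_def[symmetric] N_def[symmetric] y_def[symmetric] X_def
        flip: xX[unfolded X_def])
  also have "\<bar>\<dots>\<bar> \<le> \<bar>f (X y) - poly p (y / B)\<bar>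
      + (\<Sum>i\<le>m. \<bar>(poly p (interp_node m i / B) - poly P (X (interp_node m i))) * poly (lagrange_poly m i) y\<bar>)"
    by (intro order_trans[OF abs_triangle_ineq] add_left_mono sum_abs)
  also have "\<dots> \<le> \<eta> + (\<Sum>i\<le>m. (\<eta> + \<epsilon>) * \<bar>poly (lagrange_poly m i) y\<bar>)"
  proof (intro add_mono sum_mono \<eta> y)
    fix i assume "i \<in> {..m}"
    then have t: "interp_node m i \<in> {0..<1}" by (intro interp_node_in_unit) simp
    have "\<bar>poly p (interp_node m i / B) - poly P (X (interp_node m i))\<bar> \<le> \<eta> + \<epsilon>"
      using \<eta>[OF t] P[OF X(1)[OF t]] by linarith
    then show "\<bar>(poly p (interp_node m i / B) - poly P (X (interp_node m i))) * poly (lagrange_poly m i) y\<bar>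
        \<le> (\<eta> + \<epsilon>) * \<bar>poly (lagrange_poly m i) y\<bar>"
      unfolding abs_mult by (intro mult_right_mono) auto
  qed
  also have "\<dots> \<le> \<eta> + (\<eta> + \<epsilon>) * L"
    unfolding sum_distrib_left[symmetric] using y \<eta>0 assms
    by (intro add_left_mono mult_left_mono L) auto
  also have "\<dots> = (1 + L) * T / real b ^ (d * Suc m) + L * \<epsilon>"
  proof -
    have "(1 / B) ^ Suc m = 1 / real b ^ (d * Suc m)"
      by (simp only: B_def power_one_over power_mult)
    then have "\<eta> = T / real b ^ (d * Suc m)" by (simp add: \<eta>_def)
    then have "(1 + L) * T / real b ^ (d * Suc m) = (1 + L) * \<eta>" by simp
    then show ?thesis by (simp add: algebra_simps)
  qed
  finally show ?thesis .
qed

text \<open>The two error sources kept apart: the rank \<open>R\<close> governs the polynomial approximation, the depth \<open>d\<close>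
  the local resolution, and the constant depends on neither.\<close>

lemma piecewise_interpolant_rate:
  assumes "b \<ge> 2" "\<rho> > 1" "F holomorphic_on D_region \<rho>"
    and F: "\<And>x. x \<in> {0..<1} \<Longrightarrow> F (complex_of_real x) = complex_of_real (f x)"
  shows "\<exists>A\<ge>0. \<forall>d. \<forall>R\<ge>1. \<exists>P. degree P < R \<and>
    (\<forall>x\<in>{0..<1}. \<bar>f x - piecewise_interpolant b m P d x\<bar>
        \<le> A * (1 / \<rho> ^ R + 1 / (real b ^ (m + 1)) ^ d))"
proof -
  have f: "f x = Re (F (complex_of_real x))" if "x \<in> {0..<1}" for x using F[OF that] by simp
  obtain A0 where A0: "A0 \<ge> 0" "\<And>n. n \<ge> 1 \<Longrightarrow> \<exists>P. degree P < n \<and>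
    (\<forall>x\<in>{0..1}. cmod (F (complex_of_real x) - poly P (complex_of_real x)) \<le> A0 / \<rho> ^ n)"
    using bernstein_approximation[OF assms(2,3)] by blast
  have "complex_of_real ` {0..1} \<subseteq> D_region \<rho>"
    using unit_interval_subset_D_region[OF assms(2)] by blast
  from real_taylor_uniform[OF open_D_region this assms(3), of m]
  obtain T where T: "T \<ge> 0" "\<And>x0. x0 \<in> {0..1} \<Longrightarrow> \<exists>p. degree p \<le> m \<and>
    (\<forall>x\<in>{0..1}. \<bar>Re (F (complex_of_real x)) - poly p (x - x0)\<bar> \<le> T * \<bar>x - x0\<bar> ^ Suc m)"
    by blast
  have Tf: "\<exists>p. degree p \<le> m \<and>
      (\<forall>x\<in>{0..<1}. \<bar>f x - poly p (x - x0)\<bar> \<le> T * \<bar>x - x0\<bar> ^ Suc m)" if "x0 \<in> {0..<1}" for x0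
    using T(2)[of x0] that f by fastforce
  obtain L where L: "L \<ge> 0" "\<And>y. y \<in> {0..1} \<Longrightarrow> (\<Sum>i\<le>m. \<bar>poly (lagrange_poly m i) y\<bar>) \<le> L"
    using lebesgue_function_bounded by blast
  define A where "A = (1 + L) * T + L * A0"
  show ?thesis
  proof (intro exI[of _ A] conjI allI impI)
    show "A \<ge> 0" using A0 T L by (simp add: A_def)
    fix d R :: nat assume "R \<ge> 1"
    then obtain P where P: "degree P < R"
      "\<And>x. x \<in> {0..1} \<Longrightarrow> cmod (F (complex_of_real x) - poly P (complex_of_real x)) \<le> A0 / \<rho> ^ R"
      using A0(2) by blast
    have "degree (map_poly Re P) < R"
      using P(1) degree_map_poly_Re_le[of P] by simp
    moreover have "\<bar>f x - piecewise_interpolant b m (map_poly Re P) d x\<bar>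
        \<le> A * (1 / \<rho> ^ R + 1 / (real b ^ (m + 1)) ^ d)" if x: "x \<in> {0..<1}" for x
    proof -
      have \<epsilon>: "0 \<le> A0 / \<rho> ^ R" using A0 assms by simp
      have P': "\<bar>f x - poly (map_poly Re P) x\<bar> \<le> A0 / \<rho> ^ R" if "x \<in> {0..<1}" for x
        unfolding f[OF that] poly_map_poly_Re minus_complex.simps(1)[symmetric]
        using that by (intro order_trans[OF abs_Re_le_cmod] P) auto
      have "\<bar>f x - piecewise_interpolant b m (map_poly Re P) d x\<bar>
          \<le> (1 + L) * T / real b ^ (d * Suc m) + L * (A0 / \<rho> ^ R)"
        by (rule piecewise_interpolant_error[OF assms(1) L(1) T(1) \<epsilon> L(2) Tf P' x])
      also have "\<dots> = (1 + L) * T * (1 / (real b ^ (m + 1)) ^ d) + L * A0 * (1 / \<rho> ^ R)"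
      proof -
        have "(real b ^ (m + 1)) ^ d = real b ^ (d * Suc m)"
          by (metis power_mult mult.commute Suc_eq_plus1)
        then show ?thesis by simp
      qed
      also have "\<dots> \<le> A * (1 / (real b ^ (m + 1)) ^ d) + A * (1 / \<rho> ^ R)"
        unfolding A_def using A0 T L assms by (intro add_mono mult_right_mono) auto
      finally show ?thesis by (simp add: distrib_left add.commute)
    qed
    ultimately show "\<exists>P. degree P < R \<and> (\<forall>x\<in>{0..<1}. \<bar>f x - piecewise_interpolant b m P d x\<bar>
        \<le> A * (1 / \<rho> ^ R + 1 / (real b ^ (m + 1)) ^ d))" by blast
  qed
qed

section \<open>Best approximation errors\<close>

text \<open>The measurability assumptions matter because \<open>esssup\<close> is infinite on nonmeasurable functions.\<close>

lemma Linf_norm_diff_le: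
  assumes "continuous_on {0..<1} f" "g \<in> borel_measurable borel"
    and "\<And>x. x \<in> {0..<1} \<Longrightarrow> \<bar>f x - g x\<bar> \<le> c"
  shows "Linf_norm (\<lambda>x. f x - g x) \<le> ereal c"
  unfolding Linf_norm_def
proof (rule esssup_I)
  have "f \<in> borel_measurable (lebesgue_on {0..<1})"
    using assms(1) by (rule continuous_imp_measurable_on_sets_lebesgue) simp
  moreover have "g \<in> borel_measurable (lebesgue_on {0..<1})"
    using assms(2) by (intro measurable_restrict_space1 measurable_completion) simp
  ultimately show "(\<lambda>x. ereal \<bar>f x - g x\<bar>) \<in> borel_measurable (lebesgue_on {0..<1})"
    by measurable
  show "AE x in lebesgue_on {0..<1}. ereal \<bar>f x - g x\<bar> \<le> ereal c"
    using assms(3) by (intro AE_I2) (simp add: space_restrict_space)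
qed

lemma borel_measurable_piecewise_interpolant:
  "piecewise_interpolant b m P d \<in> borel_measurable borel"
proof -
  have [measurable]: "poly p \<in> borel_measurable borel" for p :: "real poly"
    by (intro borel_measurable_continuous_onI continuous_intros)
  show ?thesis unfolding piecewise_interpolant_def[abs_def] by measurable
qed

lemma best_error_le:
  assumes "g \<in> approx_set cpl b m \<phi> n" "Linf_norm (\<lambda>x. f x - g x) \<le> c"
  shows "best_error cpl b m \<phi> n f \<le> c"
  unfolding best_error_def by (rule INF_lower2[OF assms(1)]) (rule assms(2))

lemma best_error_le_piecewise_interpolant:
  assumes "b \<ge> 1" "d \<ge> 1" "degree P < R" "poly_basis m \<phi>" "continuous_on {0..<1} f"
    and "\<And>x. x \<in> {0..<1} \<Longrightarrow> \<bar>f x - piecewise_interpolant b m P d x\<bar> \<le> c"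
    and "\<And>v. depth v = d \<Longrightarrow> rank v = (\<lambda>_. R) \<Longrightarrow> cpl b m v \<le> n"
  shows "best_error cpl b m \<phi> n f \<le> ereal c"
proof (rule best_error_le)
  show "piecewise_interpolant b m P d \<in> approx_set cpl b m \<phi> n"
  proof -
    obtain v where "wf_network v" "realizes b m \<phi> v (piecewise_interpolant b m P d)"
      "depth v = d" "rank v = (\<lambda>_. R)"
      by (rule network_realizing_piecewise_interpolant[OF assms(1-4)])
    with assms(7)[of v] show ?thesis unfolding approx_set_def by blast
  qed
  show "Linf_norm (\<lambda>x. f x - piecewise_interpolant b m P d x) \<le> ereal c"
    using assms(5,6) borel_measurable_piecewise_interpolant by (intro Linf_norm_diff_le) auto
qed

text \<open>\<open>compl_C\<close> counts all entries of the cores, \<open>compl_S\<close> the nonzero ones.\<close>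

lemma compl_S_le_compl_C: "compl_S b m v \<le> compl_C b m v"
proof -
  have "card {(i, k). i < b \<and> k \<in> {1..rank v 1} \<and> first_core v i k \<noteq> 0}
      \<le> card ({..<b} \<times> {1..rank v 1})"
    by (intro card_mono) auto
  moreover have "card {(i, k, l). i < b \<and> k \<in> {1..rank v (\<nu> - 1)} \<and> l \<in> {1..rank v \<nu>}
          \<and> mid_core v \<nu> i k l \<noteq> 0} \<le> card ({..<b} \<times> {1..rank v (\<nu> - 1)} \<times> {1..rank v \<nu>})" for \<nu>
    by (intro card_mono) auto
  then have "(\<Sum>\<nu>=2..depth v. card {(i, k, l). i < b \<and> k \<in> {1..rank v (\<nu> - 1)} \<and> l \<in> {1..rank v \<nu>}
          \<and> mid_core v \<nu> i k l \<noteq> 0}) \<le> (\<Sum>\<nu>=2..depth v. b * (rank v (\<nu> - 1) * rank v \<nu>))"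
    by (intro sum_mono) (simp add: card_cartesian_product)
  moreover have "card {(k, q). k \<in> {1..rank v (depth v)} \<and> q \<in> {1..m+1} \<and> last_core v k q \<noteq> 0}
      \<le> card ({1..rank v (depth v)} \<times> {1..m+1})"
    by (intro card_mono) auto
  ultimately show ?thesis
    unfolding compl_S_def compl_C_def by (simp add: card_cartesian_product sum_distrib_left)
qed

lemma E_S_le_E_C: "E_S b m \<phi> n f \<le> E_C b m \<phi> n f"
  unfolding best_error_def approx_set_def
  by (rule INF_superset_mono) (auto intro: le_trans[OF compl_S_le_compl_C])

text \<open>Rounding the exponent \<open>t\<close> down to an integer costs at most one factor \<open>\<beta>\<close>.\<close>

lemma inverse_power_le_powr:
  assumes "1 < \<mu>" "\<mu> \<le> \<beta>" "t \<ge> 0" "t - 1 \<le> real s"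
  shows "1 / \<beta> ^ s \<le> \<beta> * \<mu> powr (- t)"
proof -
  have "1 / \<beta> ^ s = \<beta> powr (- real s)"
    using assms by (simp add: powr_minus powr_realpow divide_inverse)
  also have "\<dots> \<le> \<beta> powr (1 - t)"
    using assms by (intro powr_mono) auto
  also have "\<dots> = \<beta> * \<beta> powr (- t)"
    using assms by (simp add: powr_diff powr_minus divide_inverse)
  also have "\<dots> \<le> \<beta> * \<mu> powr (- t)"
    using assms by (intro mult_left_mono powr_mono2') auto
  finally show ?thesis .
qed

theorem theorem5p18:
  fixes b m :: nat and \<rho> :: real and f :: "real \<Rightarrow> real"
  assumes "b \<ge> 2"
    and "\<rho> > 1"
    and "has_analytic_extension f (D_region \<rho>)"
    and "\<And>\<rho>'. \<rho>' > \<rho> \<Longrightarrow> \<not> has_analytic_extension f (D_region \<rho>')"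
  shows "\<exists>C::real. \<forall>\<phi>. poly_basis m \<phi> \<longrightarrow> (\<forall>n\<ge>1.
           E_N b m \<phi> n f
             \<le> ereal (C * (min \<rho> (real b ^ (m + 1))) powr (- (real n powr (1/2))))
         \<and> E_S b m \<phi> n f \<le> E_C b m \<phi> n f
         \<and> E_C b m \<phi> n f
             \<le> ereal (C * (min \<rho> (real b powr (real (m + 1) / real b))) powr (- (real n powr (1/3)))))"
proof -
  obtain F where an: "F analytic_on D_region \<rho>"
    and F: "\<And>x. x \<in> {0..<1} \<Longrightarrow> F (complex_of_real x) = complex_of_real (f x)"
    using assms(3) by (auto simp: has_analytic_extension_def)
  have hol: "F holomorphic_on D_region \<rho>" using an by (rule analytic_imp_holomorphic)
  have f: "f x = Re (F (complex_of_real x))" if "x \<in> {0..<1}" for x using F[OF that] by simp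
  have "continuous_on (complex_of_real ` {0..1}) F"
    using hol unit_interval_subset_D_region[OF assms(2)]
    by (intro continuous_on_subset[OF holomorphic_on_imp_continuous_on[OF hol]]) auto
  then have "continuous_on {0..1} (\<lambda>x. F (complex_of_real x))"
    by (rule continuous_on_compose2) (auto intro!: continuous_on_of_real_id)
  then have cont01: "continuous_on {0..1} (\<lambda>x. Re (F (complex_of_real x)))"
    by (rule continuous_on_Re)
  then have "continuous_on {0..<1} (\<lambda>x. Re (F (complex_of_real x)))"
    by (rule continuous_on_subset) auto
  then have cont: "continuous_on {0..<1} f"
    using f by (subst continuous_on_cong[OF refl f]) auto
  have "bounded ((\<lambda>x. Re (F (complex_of_real x))) ` {0..1})"
    using cont01 by (intro compact_imp_bounded compact_continuous_image) auto
  then obtain M where M: "M > 0" "\<And>x. x \<in> {0..1} \<Longrightarrow> \<bar>Re (F (complex_of_real x))\<bar> \<le> M"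
    unfolding bounded_pos by auto
  obtain A where A: "A \<ge> 0" "\<And>d R. R \<ge> 1 \<Longrightarrow> \<exists>P. degree P < R \<and>
    (\<forall>x\<in>{0..<1}. \<bar>f x - piecewise_interpolant b m P d x\<bar>
        \<le> A * (1 / \<rho> ^ R + 1 / (real b ^ (m + 1)) ^ d))"
    using piecewise_interpolant_rate[OF assms(1,2) hol F, where m = m] by blast
  define B where "B = real b ^ (m + 1)"
  define \<mu> where "\<mu> = min \<rho> B"
  define \<mu>' where "\<mu>' = min \<rho> (real b powr (real (m + 1) / real b))"
  have "B > 1" unfolding B_def using assms(1) by (intro one_less_power) auto
  then have \<mu>: "\<mu> > 1" using assms(2) by (simp add: \<mu>_def)
  have \<mu>': "\<mu>' > 1" unfolding \<mu>'_def using assms(1,2) by (auto intro!: gr_one_powr)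
  \<comment> \<open>beyond \<open>t0\<close>, the full-rank cost \<open>b d R\<^sup>2\<close> dominates the boundary cores\<close>
  define t0 where "t0 = real (b + m + 1)"
  define C where "C = A * (\<rho> + B) + M * \<mu>' powr t0"
  have CA: "A * (\<rho> + B) \<le> C" and CM: "M * \<mu>' powr t0 \<le> C"
    using A M assms(2) \<open>B > 1\<close> by (auto simp: C_def)
  show ?thesis
  proof (intro exI[of _ C] allI impI conjI)
    fix \<phi> and n :: nat assume \<phi>: "poly_basis m \<phi>" and n: "n \<ge> 1"
    show "E_S b m \<phi> n f \<le> E_C b m \<phi> n f" by (rule E_S_le_E_C)
    have "E_N b m \<phi> n f \<le> ereal (C * \<mu> powr - (real n powr (1/2)))"
    proof -
      define t where "t = real n powr (1/2)"
      have t2: "t * t = real n" using n by (simp add: t_def powr_add[symmetric])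
      have t1: "t \<ge> 1" using n by (simp add: t_def ge_one_powr_ge_zero)
      \<comment> \<open>depth and rank both \<open>\<lfloor>\<surd>n\<rfloor>\<close>, for a total rank of at most \<open>n\<close>\<close>
      define s where "s = nat \<lfloor>t\<rfloor>"
      have s: "s \<ge> 1" "real s \<le> t" "t - 1 \<le> real s"
        using t1 unfolding s_def by (simp_all add: le_nat_iff le_floor_iff; linarith)+
      obtain P where P: "degree P < s"
        "\<And>x. x \<in> {0..<1} \<Longrightarrow> \<bar>f x - piecewise_interpolant b m P s x\<bar> \<le> A * (1 / \<rho> ^ s + 1 / B ^ s)"
        using A(2)[OF s(1), of s] unfolding B_def by blast
      have "real (s * s) \<le> t * t" unfolding of_nat_mult using s by (intro mult_mono) auto
      then have ss: "s * s \<le> n" unfolding t2 by (simp only: of_nat_le_iff)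
      have "E_N b m \<phi> n f \<le> ereal (A * (1 / \<rho> ^ s + 1 / B ^ s))"
        using assms(1) s ss by (intro best_error_le_piecewise_interpolant[OF _ _ P(1) \<phi> cont P(2)])
          (auto simp: compl_N_def)
      also have "A * (1 / \<rho> ^ s + 1 / B ^ s) \<le> A * (\<rho> * \<mu> powr (- t) + B * \<mu> powr (- t))"
        using A(1) \<mu> s t1
        by (intro mult_left_mono add_mono inverse_power_le_powr) (auto simp: \<mu>_def)
      also have "\<dots> = A * (\<rho> + B) * \<mu> powr (- t)" by (simp add: algebra_simps)
      also have "\<dots> \<le> C * \<mu> powr (- t)" by (intro mult_right_mono CA) auto
      finally show ?thesis by (simp add: t_def)
    qed
    then show "E_N b m \<phi> n f \<le> ereal (C * min \<rho> (real b ^ (m + 1)) powr - (real n powr (1/2)))"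
      by (simp only: \<mu>_def B_def)
    have "E_C b m \<phi> n f \<le> ereal (C * \<mu>' powr - (real n powr (1/3)))"
    proof -
      define t where "t = real n powr (1/3)"
      have t3: "t * t * t = real n" using n by (simp add: t_def powr_add[symmetric])
      have t0: "t \<ge> 0" by (simp add: t_def)
      show ?thesis
      proof (cases "t \<ge> t0")
        case False
        \<comment> \<open>only finitely many \<open>n\<close> are concerned, and the zero function is good enough for them\<close>
        have "E_C b m \<phi> n f \<le> ereal M"
          using cont M f by (intro best_error_le[of "\<lambda>_. 0"] Linf_norm_diff_le) (auto simp: approx_set_def)
        also have "M * 1 \<le> M * \<mu>' powr (t0 - t)"
          using M \<mu>' False by (intro mult_left_mono ge_one_powr_ge_zero) auto
        then have "M \<le> M * \<mu>' powr t0 * \<mu>' powr (- t)"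
          by (simp add: powr_diff powr_minus divide_inverse mult.assoc)
        also have "\<dots> \<le> C * \<mu>' powr (- t)" by (intro mult_right_mono CM) auto
        finally show ?thesis by (simp add: t_def)
      next
        case True
        \<comment> \<open>balancing \<open>\<rho>\<^sup>-\<^sup>R\<close> and \<open>b\<^sup>-\<^sup>(\<^sup>m\<^sup>+\<^sup>1\<^sup>)\<^sup>d\<close> under the constraint \<open>b d R\<^sup>2 \<le> n\<close>\<close>
        define R where "R = nat \<lfloor>t\<rfloor>"
        define d where "d = nat \<lfloor>t / real b\<rfloor>"
        have b0: "real b > 0" using assms(1) by simp
        have tb: "t / real b \<ge> 1" using True b0 by (simp add: t0_def)
        have R: "R \<ge> b + m + 1" "real R \<le> t" "t - 1 \<le> real R"
          using True unfolding R_def t0_def by (simp_all add: le_nat_iff le_floor_iff; linarith)+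
        have d: "d \<ge> 1" "real d \<le> t / real b" "t / real b - 1 \<le> real d"
          using tb unfolding d_def by (simp_all add: le_nat_iff le_floor_iff; linarith)+
        have "R \<ge> 1" using R by simp
        then obtain P where P: "degree P < R"
          "\<And>x. x \<in> {0..<1} \<Longrightarrow> \<bar>f x - piecewise_interpolant b m P d x\<bar> \<le> A * (1 / \<rho> ^ R + 1 / B ^ d)"
          using A(2)[of R d] unfolding B_def by blast
        have "real (b * d * R * R) = real b * real d * (real R * real R)" by simp
        also have "\<dots> \<le> real b * (t / real b) * (t * t)"
          using R(2) d(2) t0 by (intro mult_mono) auto
        also have "\<dots> = real n" using b0 t3 by simp
        finally have bdRR: "b * d * R * R \<le> n" by (simp only: of_nat_le_iff)
        \<comment> \<open>the first and the last core fit into the one block \<open>b R\<^sup>2\<close> saved by having only \<open>d - 1\<close> middle cores\<close>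
        have "b * R + R * (m + 1) = (b + m + 1) * R" by (simp add: algebra_simps)
        also have "\<dots> \<le> R * R" using R(1) by (intro mult_right_mono) auto
        also have "\<dots> \<le> b * (R * R)" using assms(1) by simp
        finally have "b * R + b * ((d - 1) * (R * R)) + R * (m + 1) \<le> b * (R * R) + b * ((d - 1) * (R * R))"
          by simp
        also have "\<dots> = b * (((d - 1) + 1) * (R * R))" by (simp only: distrib_left distrib_right)
        also have "\<dots> = b * d * R * R" using d(1) by simp
        finally have cost: "b * R + b * ((d - 1) * (R * R)) + R * (m + 1) \<le> n" using bdRR by simp
        have "E_C b m \<phi> n f \<le> ereal (A * (1 / \<rho> ^ R + 1 / B ^ d))"
        proof (rule best_error_le_piecewise_interpolant[OF _ d(1) P(1) \<phi> cont P(2)])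
          fix v :: tensor_network assume "depth v = d" "rank v = (\<lambda>_. R)"
          then show "compl_C b m v \<le> n"
            using cost d(1) by (simp add: compl_C_def)
        next
          show "1 \<le> b" using assms(1) by simp
        qed
        also have "A * (1 / \<rho> ^ R + 1 / B ^ d) \<le> A * (\<rho> * \<mu>' powr (- t) + B * \<mu>' powr (- t))"
        proof (intro mult_left_mono add_mono A(1))
          show "1 / \<rho> ^ R \<le> \<rho> * \<mu>' powr (- t)"
            using \<mu>' R(3) t0 by (intro inverse_power_le_powr) (auto simp: \<mu>'_def)
          have "1 / B ^ d \<le> B * B powr (- (t / real b))"
            using \<open>B > 1\<close> tb d by (intro inverse_power_le_powr) auto
          also have "B powr (- (t / real b)) = (real b powr (real (m + 1) / real b)) powr (- t)"
          proof -
            have "B = real b powr real (m + 1)"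
              unfolding B_def using b0 by (simp add: powr_realpow del: of_nat_Suc of_nat_add)
            then show ?thesis by (simp add: powr_powr)
          qed
          also have "B * (real b powr (real (m + 1) / real b)) powr (- t) \<le> B * \<mu>' powr (- t)"
            using b0 \<mu>' t0 \<open>B > 1\<close> by (intro mult_left_mono powr_mono2') (auto simp: \<mu>'_def)
          finally show "1 / B ^ d \<le> B * \<mu>' powr (- t)" .
        qed
        also have "\<dots> = A * (\<rho> + B) * \<mu>' powr (- t)" by (simp add: algebra_simps)
        also have "\<dots> \<le> C * \<mu>' powr (- t)" by (intro mult_right_mono CA) auto
        finally show ?thesis by (simp add: t_def)
      qed
    qed
    then show "E_C b m \<phi> n f
        \<le> ereal (C * min \<rho> (real b powr (real (m + 1) / real b)) powr - (real n powr (1/3)))"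
      by (simp only: \<mu>'_def)
  qed
qed

end
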